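(* Fix $p\in[1,\infty]$. Let $\xi=(\xi_j)_{j\ge1}$ be a random sequence that is swap-invariant under a probability measure $\mathbf{P}$ such that $\|\xi\|_p^{(n)}\to\|\xi\|_p$ as $n\to\infty$ $\mathbf{P}$-almost surely and in $L^1(\mathbf{P})$, and $\mathbf{E}_{\mathbf{P}}\|\xi\|_p>0$. Define another probability measure $\mathbf{Q}$ by $$\frac{\mathrm{d}\mathbf{Q}}{\mathrm{d}\mathbf{P}}=\frac{\|\xi\|_p}{\mathbf{E}_{\mathbf{P}}\|\xi\|_p}.$$ (i) Let $\varepsilon$ be a random variable that takes values $\pm1$ with probabilities $1/2$ and is independent of $\xi$ under $\mathbf{P}$. Then there exists a random sequence $\zeta=(\zeta_j)_{j\ge1}$ that is exchangeable under $\mathbf{Q}$ such that $\varepsilon\,\xi_j=\|\xi\|_p\,\zeta_j$ $\mathbf{P}$-almost surely for each $j\ge1$. (ii) If $\xi$ is either symmetric or non-negative, then there exists a random sequence $\eta=(\eta_j)_{j\ge1}$ that is exchangeable under $\mathbf{Q}$ such that $\xi_j=\|\xi\|_p\,\eta_j$ $\mathbf{P}$-almost surely for each $j\ge1$.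
   Context: For a real sequence $x=(x_j)_{j\ge1}$, $n\ge1$ and $1\le p<\infty$ put $$\|x\|_p^{(n)}=\Big(n^{-1}\sum_{j=1}^n|x_j|^p\Big)^{1/p},\qquad \|x\|_p=\limsup_{n\to\infty}\|x\|_p^{(n)}\in[0,\infty],$$ and $\|x\|_\infty^{(n)}=\max\{|x_j|:1\le j\le n\}$, $\|x\|_\infty=\limsup_{n\to\infty}\|x\|_\infty^{(n)}\in[0,\infty]$. Random sequences are sequences of real-valued random variables. A sequence $\xi$ of integrable random variables is swap-invariant if for every $n\ge1$, every permutation $\pi$ of $\{1,\dots,n\}$ and every $u\in\mathbb{R}^n$, $\mathbf{E}\,\big|\sum_{j=1}^n u_j\xi_j\big|=\mathbf{E}\,\big|\sum_{j=1}^n u_j\xi_{\pi(j)}\big|$. It is exchangeable if for every $n\ge1$ and every such $\pi$, $(\xi_{\pi(1)},\dots,\xi_{\pi(n)})$ and $(\xi_1,\dots,\xi_n)$ have the same distribution. It is symmetric if $\xi$ and $-\xi$ have the same distribution (here under $\mathbf{P}$). $\mathbf{E}_{\mathbf{P}}$ denotes expectation with respect to $\mathbf{P}$. *)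

theory Defs
  imports "HOL-Probability.Probability"
begin

text \<open>
  Sequences are indexed from 0: the value \<open>x j\<close> is the mathematical \<open>x\<^sub>j\<^sub>+\<^sub>1\<close>, so the index
  set \<open>{1,\<dots>,n}\<close> becomes \<open>{..<n}\<close>. A random sequence on a measure space \<open>M\<close> is a
  family \<open>\<xi> :: nat \<Rightarrow> 'a \<Rightarrow> real\<close> of Borel measurable functions on \<open>M\<close>.
\<close>

text \<open>
  The exponent \<open>p\<close> ranges over the extended reals with \<open>1 \<le> p\<close>. The value at \<open>n = 0\<close>
  is irrelevant, as only limits for \<open>n \<rightarrow> \<infinity>\<close> are taken.
\<close>

definition partial_norm :: "ereal \<Rightarrow> nat \<Rightarrow> (nat \<Rightarrow> real) \<Rightarrow> real" where
  "partial_norm p n x =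
     (if p = \<infinity> then Max ((\<lambda>j. \<bar>x j\<bar>) ` {..<n})
      else ((\<Sum>j<n. \<bar>x j\<bar> powr real_of_ereal p) / real n) powr (1 / real_of_ereal p))"

definition limsup_norm :: "ereal \<Rightarrow> (nat \<Rightarrow> real) \<Rightarrow> ereal" where
  "limsup_norm p x = limsup (\<lambda>n. ereal (partial_norm p n x))"

definition swap_invariant :: "'a measure \<Rightarrow> (nat \<Rightarrow> 'a \<Rightarrow> real) \<Rightarrow> bool" where
  "swap_invariant M \<xi> \<longleftrightarrow>
     (\<forall>j. integrable M (\<xi> j)) \<and>
     (\<forall>n\<ge>1. \<forall>\<pi>. \<pi> permutes {..<n} \<longrightarrow> (\<forall>u :: nat \<Rightarrow> real.
        (\<integral>\<omega>. \<bar>\<Sum>j<n. u j * \<xi> j \<omega>\<bar> \<partial>M) = (\<integral>\<omega>. \<bar>\<Sum>j<n. u j * \<xi> (\<pi> j) \<omega>\<bar> \<partial>M)))"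

definition exchangeable :: "'a measure \<Rightarrow> (nat \<Rightarrow> 'a \<Rightarrow> real) \<Rightarrow> bool" where
  "exchangeable M \<xi> \<longleftrightarrow>
     (\<forall>j. \<xi> j \<in> borel_measurable M) \<and>
     (\<forall>n\<ge>1. \<forall>\<pi>. \<pi> permutes {..<n} \<longrightarrow>
        distr M (Pi\<^sub>M {..<n} (\<lambda>_. borel)) (\<lambda>\<omega>. \<lambda>j\<in>{..<n}. \<xi> (\<pi> j) \<omega>) =
        distr M (Pi\<^sub>M {..<n} (\<lambda>_. borel)) (\<lambda>\<omega>. \<lambda>j\<in>{..<n}. \<xi> j \<omega>))"

definition symmetric_seq :: "'a measure \<Rightarrow> (nat \<Rightarrow> 'a \<Rightarrow> real) \<Rightarrow> bool" where
  "symmetric_seq M \<xi> \<longleftrightarrow>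
     (\<forall>j. \<xi> j \<in> borel_measurable M) \<and>
     distr M (Pi\<^sub>M UNIV (\<lambda>_. borel)) (\<lambda>\<omega> j. - \<xi> j \<omega>) =
     distr M (Pi\<^sub>M UNIV (\<lambda>_. borel)) (\<lambda>\<omega> j. \<xi> j \<omega>)"

text \<open>
  The library's \<open>indep_var\<close> needs both random variables to have the same value type. This is
  the characterization \<open>indep_var_eq\<close> without that restriction.
\<close>

definition indep_random_variables ::
  "'a measure \<Rightarrow> 'b measure \<Rightarrow> ('a \<Rightarrow> 'b) \<Rightarrow> 'c measure \<Rightarrow> ('a \<Rightarrow> 'c) \<Rightarrow> bool" where
  "indep_random_variables M S X T Y \<longleftrightarrow>
     X \<in> measurable M S \<and> Y \<in> measurable M T \<and>
     prob_space.indep_set M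
       (sigma_sets (space M) {X -` A \<inter> space M |A. A \<in> sets S})
       (sigma_sets (space M) {Y -` B \<inter> space M |B. B \<in> sets T})"

text \<open>
  The limit may take the value \<open>\<infinity>\<close>; the expected distance is then infinite unless this
  happens on a null set only.
\<close>

definition tendsto_L1 :: "'a measure \<Rightarrow> (nat \<Rightarrow> 'a \<Rightarrow> real) \<Rightarrow> ('a \<Rightarrow> ereal) \<Rightarrow> bool" where
  "tendsto_L1 M X Y \<longleftrightarrow>
     (\<lambda>n. \<integral>\<^sup>+ \<omega>. e2ennreal \<bar>ereal (X n \<omega>) - Y \<omega>\<bar> \<partial>M) \<longlonglongrightarrow> 0"

end

theory Submission imports Defs begin

text \<open>
  Swap-invariance says that the numbers \<open>E \<bar>\<Sum>j<n. u j * \<xi> j\<bar>\<close> do not change under permutations of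
  \<open>\<xi> 0, \<dots>, \<xi> (n - 1)\<close>. Differentiating in the direction of the \<open>i\<close>-th coordinate, these numbers
  determine all half-space probabilities of \<open>(X j / X i)\<^sub>j\<close> under the measure with density \<open>\<bar>X i\<bar>\<close>, hence
  by Cramer-Wold that law, and hence \<open>E f X\<close> for every even 1-homogeneous \<open>f \<ge> 0\<close>. The partial norms
  \<open>r n\<close> are even, 1-homogeneous and permutation invariant, so \<open>E (r n * g (\<xi> / r n))\<close> is permutation
  invariant for every bounded even \<open>g\<close>. Letting \<open>n \<rightarrow> \<infinity>\<close> gives \<open>E (R * g (\<xi> / R))\<close>, where \<open>R\<close> is the
  limit, for continuous \<open>g\<close>; up to a constant factor this is the \<open>Q\<close>-expectation of \<open>g (\<xi> / R)\<close>. Even test functions suffice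
  for laws that are symmetric or concentrated on non-negative sequences. Finally,
  \<open>E (\<bar>\<xi> j\<bar>; R = 0)\<close> does not depend on \<open>j\<close> and its average over \<open>j < n\<close> is at most
  \<open>E (r n; R = 0) \<rightarrow> 0\<close>, so that \<open>\<xi> j\<close> vanishes where \<open>R\<close> does.
\<close>

subsection \<open>Laws determined by trigonometric integrals\<close>

text \<open>The phases 0 and \<open>- (pi / 2)\<close> yield the real and imaginary parts of the
  characteristic function, so Levy's uniqueness theorem applies after scaling to total mass 1.
  Cosines with an arbitrary phase are used instead of cosines and sines because a product of two of
  them is again a combination of such functions, which the multivariate version needs.\<close>

lemma borel_measure_eqI_trig:
  fixes M1 M2 :: "real measure"
  assumes fin: "finite_measure M1" "finite_measure M2"
    and sets: "sets M1 = sets borel" "sets M2 = sets borel"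
    and trig: "\<And>\<theta> t. (\<integral>x. cos (\<theta> + t * x) \<partial>M1) = (\<integral>x. cos (\<theta> + t * x) \<partial>M2)"
  shows "M1 = M2"
proof -
  interpret M1: finite_measure M1 by fact
  interpret M2: finite_measure M2 by fact
  note [measurable_cong] = sets
  have sp: "space M1 = UNIV" "space M2 = UNIV"
    using sets by (auto dest: sets_eq_imp_space_eq)
  have cos: "(\<integral>x. cos (t * x) \<partial>M1) = (\<integral>x. cos (t * x) \<partial>M2)" for t
    using trig[of 0 t] by simp
  have sin: "(\<integral>x. sin (t * x) \<partial>M1) = (\<integral>x. sin (t * x) \<partial>M2)" for t
    using trig[of "- (pi / 2)" t] by (simp add: cos_diff)
  define c where "c = measure M1 (space M1)"
  have c2: "c = measure M2 (space M2)"
    using cos[of 0] by (simp add: c_def)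
  show ?thesis
  \<comment> \<open>The common total mass \<open>c\<close> is the case of zero frequency and phase.
    The zero measure cannot be normalised and is treated separately.\<close>
  proof (cases "c = 0")
    case True
    then have "emeasure M1 (space M1) = 0" "emeasure M2 (space M2) = 0"
      using c2 by (simp_all add: c_def M1.emeasure_eq_measure M2.emeasure_eq_measure)
    then show ?thesis
      using sets emeasure_eq_0[of "space M1" M1] emeasure_eq_0[of "space M2" M2]
      by (intro measure_eqI) (auto simp: sp)
  next
    case False
    then have c: "c > 0"
      using measure_nonneg[of M1 "space M1"] unfolding c_def by linarith
    let ?d = "\<lambda>M. density M (\<lambda>_. ennreal (1 / c))"
    have rd: "real_distribution (?d M)"
      if "finite_measure M" "sets M = sets borel" "c = measure M (space M)" for M
    proof -
      interpret finite_measure M by fact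
      have "emeasure (?d M) (space (?d M)) = ennreal (1 / c) * ennreal c"
        by (simp add: emeasure_density_const emeasure_eq_measure \<open>c = measure M (space M)\<close>)
      also have "\<dots> = 1"
        using c by (simp flip: ennreal_mult)
      finally have "prob_space (?d M)" by (rule prob_spaceI)
      then show ?thesis
        using that by (simp add: real_distribution_def real_distribution_axioms_def)
    qed
    have char: "char (?d M) t = complex_of_real ((\<integral>x. cos (t * x) \<partial>M) / c) + \<i> * complex_of_real ((\<integral>x. sin (t * x) \<partial>M) / c)"
      if "finite_measure M" "sets M = sets borel" for M t
    proof -
      interpret finite_measure M by fact
      have [measurable_cong]: "sets M = sets borel" by fact
      have i: "integrable M (\<lambda>x. cos (t * x))" "integrable M (\<lambda>x. sin (t * x))"
        by (rule integrable_const_bound[where B=1]; simp)+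
      have "char (?d M) t = (\<integral>x. (1 / c) *\<^sub>R iexp (t * x) \<partial>M)"
        unfolding char_def using c by (subst integral_density) auto
      also have "\<dots> = (\<integral>x. complex_of_real (cos (t * x) / c) + \<i> * complex_of_real (sin (t * x) / c) \<partial>M)"
        by (intro Bochner_Integration.integral_cong) (auto simp: complex_eq_iff Re_exp Im_exp)
      also have "\<dots> = (\<integral>x. complex_of_real (cos (t * x) / c) \<partial>M) + \<i> * (\<integral>x. complex_of_real (sin (t * x) / c) \<partial>M)"
        using i by (subst Bochner_Integration.integral_add) auto
      also have "\<dots> = complex_of_real ((\<integral>x. cos (t * x) \<partial>M) / c) + \<i> * complex_of_real ((\<integral>x. sin (t * x) \<partial>M) / c)"
        by (simp only: integral_complex_of_real integral_divide_zero)
      finally show ?thesis .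
    qed
    have "?d M1 = ?d M2"
      by (intro Levy_uniqueness rd fin sets c_def c2) (simp add: fun_eq_iff char fin sets cos sin)
    then have eq: "ennreal (1 / c) * emeasure M1 A = ennreal (1 / c) * emeasure M2 A" if "A \<in> sets borel" for A
      using that sets \<open>?d M1 = ?d M2\<close> by (metis emeasure_density_const)
    \<comment> \<open>Undoes the scaling; \<open>c\<close> is positive and finite, so the
      cancellation also holds for infinite \<open>x\<close>.\<close>
    have "ennreal c * (ennreal (1 / c) * x) = x" for x
      using c by (simp add: mult.assoc[symmetric] flip: ennreal_mult)
    then have "emeasure M1 A = emeasure M2 A" if "A \<in> sets borel" for A
      using eq[OF that] by metis
    then show ?thesis
      using sets by (intro measure_eqI) auto
  qed
qed

text \<open>
  The two measures are shown to agree on boxes, treating one coordinate at a time: the weight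
  \<open>W * (1 + cos (\<theta> + \<Sum>i\<in>I. u i * x i))\<close>, with \<open>W\<close> the indicator of the coordinates already treated, is
  non-negative, so the one-dimensional lemma applies to the weighted law of the next coordinate.
\<close>

lemma PiM_measure_eqI_trig:
  fixes M1 M2 :: "('i \<Rightarrow> real) measure"
  assumes I: "finite I"
    and fin: "finite_measure M1" "finite_measure M2"
    and sets: "sets M1 = sets (Pi\<^sub>M I (\<lambda>_. borel))" "sets M2 = sets (Pi\<^sub>M I (\<lambda>_. borel))"
    and trig: "\<And>\<theta> u. (\<integral>x. cos (\<theta> + (\<Sum>i\<in>I. u i * x i)) \<partial>M1) = (\<integral>x. cos (\<theta> + (\<Sum>i\<in>I. u i * x i)) \<partial>M2)"
  shows "M1 = M2"
proof -
  note [measurable_cong] = sets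
  interpret M1: finite_measure M1 by fact
  interpret M2: finite_measure M2 by fact
  let ?L = "\<lambda>(u :: 'i \<Rightarrow> real) x. \<Sum>i\<in>I. u i * x i"
  have L_meas[measurable]: "?L u \<in> borel_measurable (Pi\<^sub>M I (\<lambda>_. borel))" for u
    by (intro borel_measurable_sum borel_measurable_times) auto
  \<comment> \<open>Used with \<open>c\<close> equal to 0, 1 and -1: the frequency \<open>t\<close>
    of the new coordinate alone, plus \<open>u\<close>, and minus \<open>u\<close>.\<close>
  have Ladd: "?L (\<lambda>i. c * u i + (if i = j then t else 0)) x = c * ?L u x + t * x j" if "j \<in> I" for u c j t x
  proof -
    have "?L (\<lambda>i. c * u i + (if i = j then t else 0)) x = (\<Sum>i\<in>I. c * (u i * x i) + (if i = j then t * x j else 0))"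
      by (intro sum.cong) (auto simp: algebra_simps)
    also have "\<dots> = c * ?L u x + t * x j"
      using that I by (simp add: sum.distrib sum_distrib_left)
    finally show ?thesis .
  qed
  have *: "(\<integral>x. (\<Prod>j\<in>J. indicator (B j) (x j)) * cos (\<theta> + ?L u x) \<partial>M1) =
      (\<integral>x. (\<Prod>j\<in>J. indicator (B j) (x j)) * cos (\<theta> + ?L u x) \<partial>M2)"
    if "finite J" "J \<subseteq> I" "\<And>j. j \<in> I \<Longrightarrow> B j \<in> sets borel" for J \<theta> u and B :: "'i \<Rightarrow> real set"
    using that(1,2)
  proof (induction J arbitrary: \<theta> u rule: finite_induct)
    case empty
    then show ?case using trig by simp
  next
    case (insert j J)
    define W :: "('i \<Rightarrow> real) \<Rightarrow> real" where "W x = (\<Prod>j\<in>J. indicator (B j) (x j))" for x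
    have jI[measurable]: "j \<in> I" and JI: "J \<subseteq> I" using insert by auto
    have [measurable]: "\<And>j. j \<in> I \<Longrightarrow> B j \<in> sets borel" by fact
    have W: "0 \<le> W x" "W x \<le> 1" for x
      unfolding W_def by (auto intro!: prod_nonneg prod_le_1)
    have W_meas[measurable]: "W \<in> borel_measurable (Pi\<^sub>M I (\<lambda>_. borel))"
      unfolding W_def
    proof (intro borel_measurable_prod)
      fix i assume "i \<in> J"
      then have [measurable]: "i \<in> I" using JI by auto
      show "(\<lambda>x. indicator (B i) (x i) :: real) \<in> borel_measurable (Pi\<^sub>M I (\<lambda>_. borel))"
        by measurable
    qed
    have IH: "(\<integral>x. W x * cos (\<theta> + ?L u x) \<partial>M1) = (\<integral>x. W x * cos (\<theta> + ?L u x) \<partial>M2)" for \<theta> u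
      using insert JI by (simp add: W_def)
    have int: "integrable M (\<lambda>x. W x * cos (\<theta> + ?L u x))"
      if M: "finite_measure M" "sets M = sets (Pi\<^sub>M I (\<lambda>_. borel))" for M \<theta> u
    proof -
      interpret finite_measure M by fact
      note [measurable_cong] = M(2)
      have "\<bar>W x * cos (\<theta> + ?L u x)\<bar> \<le> 1" for x
        using W[of x] by (auto simp: abs_mult intro!: mult_le_one)
      then show ?thesis
        by (intro integrable_const_bound[where B=1]) auto
    qed
    have key: "(\<integral>x. indicator (B j) (x j) * (W x * (1 + cos (\<theta> + ?L u x))) \<partial>M1) =
      (\<integral>x. indicator (B j) (x j) * (W x * (1 + cos (\<theta> + ?L u x))) \<partial>M2)" for \<theta> u
    proof -
      define w where "w x = W x * (1 + cos (\<theta> + ?L u x))" for x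
      have [measurable]: "w \<in> borel_measurable (Pi\<^sub>M I (\<lambda>_. borel))"
        unfolding w_def by measurable
      have nn: "0 \<le> w x" for x
        unfolding w_def using W[of x] cos_ge_minus_one[of "\<theta> + ?L u x"]
        by (intro mult_nonneg_nonneg) linarith+
      \<comment> \<open>The law of the coordinate \<open>j\<close> under the non-negative weight
        \<open>w\<close>. Adding 1 to the cosine is what makes \<open>w\<close>
        non-negative.\<close>
      define D where "D M = distr (density M (\<lambda>x. ennreal (w x))) borel (\<lambda>x. x j)" for M :: "('i \<Rightarrow> real) measure"
      have D_int: "(\<integral>y. h y \<partial>D M) = (\<integral>x. h (x j) * w x \<partial>M)"
        if M: "sets M = sets (Pi\<^sub>M I (\<lambda>_. borel))" and [measurable]: "h \<in> borel_measurable borel"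
        for M and h :: "real \<Rightarrow> real"
      proof -
        note [measurable_cong] = M
        have "(\<integral>y. h y \<partial>D M) = (\<integral>x. h (x j) \<partial>density M (\<lambda>x. ennreal (w x)))"
          unfolding D_def by (rule integral_distr) measurable
        also have "\<dots> = (\<integral>x. w x *\<^sub>R h (x j) \<partial>M)"
          by (rule integral_density) (auto simp: nn)
        finally show ?thesis by (simp add: mult.commute)
      qed
      have D_fin: "finite_measure (D M)"
        if M: "finite_measure M" "sets M = sets (Pi\<^sub>M I (\<lambda>_. borel))" for M
      proof -
        note [measurable_cong] = M(2)
        have i: "integrable M w"
          using Bochner_Integration.integrable_add[OF int[OF M, of 0 "\<lambda>_. 0"] int[OF M, of \<theta> u]]
          by (simp add: algebra_simps w_def[abs_def])
        have "emeasure (D M) (space (D M)) = (\<integral>\<^sup>+x. ennreal (w x) \<partial>M)"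
          unfolding D_def by (subst emeasure_distr) (auto simp: emeasure_density intro!: nn_integral_cong)
        also have "\<dots> < \<infinity>"
          using i nn by (subst nn_integral_eq_integral) auto
        finally show ?thesis by (intro finite_measureI) auto
      qed
      have "D M1 = D M2"
      proof (rule borel_measure_eqI_trig)
        show "finite_measure (D M1)" "finite_measure (D M2)"
          using D_fin fin sets by auto
        show "sets (D M1) = sets borel" "sets (D M2) = sets borel" by (auto simp: D_def)
        fix \<phi> t :: real
        let ?u = "\<lambda>c i. c * u i + (if i = j then t else 0)"
        \<comment> \<open>The product-to-sum formula for
          \<open>cos (\<phi> + t * x j) * cos (\<theta> + ?L u x)\<close> leaves three integrals of
          the form covered by the induction hypothesis, with new phases and frequencies.\<close>
        have expand: "(\<integral>x. cos (\<phi> + t * x j) * w x \<partial>M) = (\<integral>x. W x * cos (\<phi> + ?L (?u 0) x) \<partial>M) +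
            ((\<integral>x. W x * cos ((\<phi> + \<theta>) + ?L (?u 1) x) \<partial>M) + (\<integral>x. W x * cos ((\<phi> - \<theta>) + ?L (?u (-1)) x) \<partial>M)) / 2"
          if M: "finite_measure M" "sets M = sets (Pi\<^sub>M I (\<lambda>_. borel))" for M
        proof -
          have prod: "2 * (cos (\<phi> + t * x j) * cos (\<theta> + ?L u x)) =
              cos ((\<phi> + \<theta>) + ?L (?u 1) x) + cos ((\<phi> - \<theta>) + ?L (?u (-1)) x)" for x
          proof -
            have "(\<phi> + \<theta>) + ?L (?u 1) x = (\<phi> + t * x j) + (\<theta> + ?L u x)"
              "(\<phi> - \<theta>) + ?L (?u (-1)) x = (\<phi> + t * x j) - (\<theta> + ?L u x)"
              unfolding Ladd[OF jI] by simp_all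
            then show ?thesis by (simp only: cos_add[of "\<phi> + t * x j"] cos_diff[of "\<phi> + t * x j"])
          qed
          have "cos (\<phi> + t * x j) * w x = W x * cos (\<phi> + ?L (?u 0) x) +
              (W x * cos ((\<phi> + \<theta>) + ?L (?u 1) x) + W x * cos ((\<phi> - \<theta>) + ?L (?u (-1)) x)) / 2" for x
          proof -
            have "cos (\<phi> + t * x j) * w x = W x * cos (\<phi> + t * x j) + W x * (2 * (cos (\<phi> + t * x j) * cos (\<theta> + ?L u x))) / 2"
              by (simp add: w_def algebra_simps)
            then show ?thesis
              using Ladd[OF jI, of 0 u t x] unfolding prod by (simp only: distrib_left mult_zero_left add_0)
          qed
          then show ?thesis
            using int[OF M] by (simp only: Bochner_Integration.integral_add integral_divide_zero Bochner_Integration.integrable_add integrable_divide_zero)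
        qed
        show "(\<integral>y. cos (\<phi> + t * y) \<partial>D M1) = (\<integral>y. cos (\<phi> + t * y) \<partial>D M2)"
          using IH by (subst (1 2) D_int) (simp_all only: sets expand fin, simp_all)
      qed
      then have "(\<integral>x. indicator (B j) (x j) * w x \<partial>M1) = (\<integral>x. indicator (B j) (x j) * w x \<partial>M2)"
        using D_int[OF sets(1), of "indicator (B j)"] D_int[OF sets(2), of "indicator (B j)"] by simp
      then show ?thesis by (simp add: w_def)
    qed
    \<comment> \<open>Removes the added 1: for zero phase and frequency the weight is
      \<open>2 * W x\<close>, so half of that instance of \<open>key\<close> is the constant
      term.\<close>
    have eq: "(\<integral>x. indicator (B j) (x j) * (W x * (1 + cos (\<theta> + ?L u x))) \<partial>M) =
      (\<integral>x. indicator (B j) (x j) * (W x * (1 + cos (0 + ?L (\<lambda>_. 0) x))) \<partial>M) / 2 + (\<integral>x. indicator (B j) (x j) * (W x * cos (\<theta> + ?L u x)) \<partial>M)"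
      if M: "finite_measure M" "sets M = sets (Pi\<^sub>M I (\<lambda>_. borel))" for M
    proof -
      note [measurable_cong] = M(2)
      have ind: "integrable M (\<lambda>x. indicator (B j) (x j) * (W x * cos (\<theta> + ?L u x)))" for \<theta> u
        by (rule Bochner_Integration.integrable_bound[OF int[OF M, of \<theta> u]]) (auto simp: indicator_def)
      have "(\<integral>x. indicator (B j) (x j) * (W x * (1 + cos (\<theta> + ?L u x))) \<partial>M) =
        (\<integral>x. indicator (B j) (x j) * (W x * cos (0 + ?L (\<lambda>_. 0) x)) + indicator (B j) (x j) * (W x * cos (\<theta> + ?L u x)) \<partial>M)"
        by (simp add: algebra_simps)
      also have "\<dots> = (\<integral>x. indicator (B j) (x j) * (W x * cos (0 + ?L (\<lambda>_. 0) x)) \<partial>M) + (\<integral>x. indicator (B j) (x j) * (W x * cos (\<theta> + ?L u x)) \<partial>M)"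
        by (intro Bochner_Integration.integral_add ind)
      finally show ?thesis by (simp add: mult.assoc[symmetric])
    qed
    have "(\<integral>x. indicator (B j) (x j) * (W x * cos (\<theta> + ?L u x)) \<partial>M1) = (\<integral>x. indicator (B j) (x j) * (W x * cos (\<theta> + ?L u x)) \<partial>M2)"
      using eq[OF fin(1) sets(1)] eq[OF fin(2) sets(2)] key[of \<theta> u] key[of 0 "\<lambda>_. 0"] by linarith
    then show ?case
      using insert by (simp add: W_def mult.assoc)
  qed
  show ?thesis
  proof (rule measure_eqI_PiM_finite[OF I sets])
    fix B :: "'i \<Rightarrow> real set" assume B: "\<And>i. i \<in> I \<Longrightarrow> B i \<in> sets borel"
    \<comment> \<open>Once all coordinates are treated, zero phase and frequency turn the cosine
      into 1 and the integral into the measure of a box.\<close>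
    have e: "(\<integral>x. (\<Prod>j\<in>I. indicator (B j) (x j)) * cos (0 + ?L (\<lambda>_. 0) x) \<partial>M) = measure M (Pi\<^sub>E I B)"
      if M: "finite_measure M" "sets M = sets (Pi\<^sub>M I (\<lambda>_. borel))" for M
    proof -
      have sp: "space M = Pi\<^sub>E I (\<lambda>_. UNIV)"
        using sets_eq_imp_space_eq[OF M(2)] by (simp add: space_PiM)
      have "(\<integral>x. (\<Prod>j\<in>I. indicator (B j) (x j)) * cos (0 + ?L (\<lambda>_. 0) x) \<partial>M) = (\<integral>x. indicator (Pi\<^sub>E I B) x \<partial>M)"
        using I by (intro Bochner_Integration.integral_cong refl)
          (auto simp: sp indicator_def PiE_iff prod.If_cases split: if_splits intro!: prod.neutral prod_zero)
      also have "\<dots> = measure M (Pi\<^sub>E I B)"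
        using M B by (simp add: sets_PiM_I_finite I)
      finally show ?thesis .
    qed
    show "emeasure M1 (Pi\<^sub>E I B) = emeasure M2 (Pi\<^sub>E I B)"
      using *[of I B 0 "\<lambda>_. 0"] I B e[OF fin(1) sets(1)] e[OF fin(2) sets(2)]
      by (auto simp: M1.emeasure_eq_measure M2.emeasure_eq_measure)
  next
    \<comment> \<open>The measures are finite, so a constant sequence serves as the cover by sets of
      finite measure.\<close>
    show "range (\<lambda>_::nat. Pi\<^sub>E I (\<lambda>_. UNIV)) \<subseteq> prod_algebra I (\<lambda>_. borel :: real measure)"
      using I by (auto intro!: prod_algebraI_finite)
    show "(\<Union>i::nat. Pi\<^sub>E I (\<lambda>_. UNIV)) = space (Pi\<^sub>M I (\<lambda>_. borel :: real measure))"
      by (simp add: space_PiM)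
    show "emeasure M1 (Pi\<^sub>E I (\<lambda>_. UNIV)) \<noteq> \<infinity>" by simp
  qed
qed

text \<open>The integrals of \<open>cos (\<theta> + (\<Sum>j<k. u j * x j))\<close> determine the
  law of a random vector by \<open>PiM_measure_eqI_trig\<close>; this is applied to the laws of the
  permuted and the original vector.\<close>

lemma exchangeableI_trig:
  assumes fin: "finite_measure M"
    and \<zeta>[measurable]: "\<And>j. \<zeta> j \<in> borel_measurable M"
    and trig: "\<And>k \<pi> \<theta> u. \<pi> permutes {..<k} \<Longrightarrow>
      (\<integral>\<omega>. cos (\<theta> + (\<Sum>j<k. u j * \<zeta> (\<pi> j) \<omega>)) \<partial>M) = (\<integral>\<omega>. cos (\<theta> + (\<Sum>j<k. u j * \<zeta> j \<omega>)) \<partial>M)"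
  shows "exchangeable M \<zeta>"
  unfolding exchangeable_def
proof (intro conjI allI impI \<zeta>)
  fix n :: nat and \<pi> assume \<pi>: "\<pi> permutes {..<n}"
  interpret finite_measure M by fact
  let ?D = "\<lambda>\<sigma>. distr M (Pi\<^sub>M {..<n} (\<lambda>_. borel)) (\<lambda>\<omega>. \<lambda>j\<in>{..<n}. \<zeta> (\<sigma> j) \<omega>)"
  have m: "(\<lambda>\<omega>. \<lambda>j\<in>{..<n}. \<zeta> (\<sigma> j) \<omega>) \<in> measurable M (Pi\<^sub>M {..<n} (\<lambda>_. borel))" for \<sigma>
    by (intro measurable_restrict) auto
  have L: "(\<lambda>x. cos (\<theta> + (\<Sum>j<n. u j * x j))) \<in> borel_measurable (Pi\<^sub>M {..<n} (\<lambda>_. borel))" for u :: "nat \<Rightarrow> real" and \<theta>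
  proof -
    have [measurable]: "(\<lambda>x. \<Sum>j<n. u j * x j) \<in> borel_measurable (Pi\<^sub>M {..<n} (\<lambda>_. borel))"
      by (intro borel_measurable_sum borel_measurable_times) auto
    show ?thesis by measurable
  qed
  have int: "(\<integral>x. cos (\<theta> + (\<Sum>j<n. u j * x j)) \<partial>?D \<sigma>) = (\<integral>\<omega>. cos (\<theta> + (\<Sum>j<n. u j * \<zeta> (\<sigma> j) \<omega>)) \<partial>M)" for u \<sigma> \<theta>
    by (subst integral_distr[OF m L]) simp
  have "?D \<pi> = ?D (\<lambda>j. j)"
  proof (rule PiM_measure_eqI_trig)
    show "finite_measure (?D \<pi>)" "finite_measure (?D (\<lambda>j. j))"
      by (intro finite_measure_distr m)+
    show "(\<integral>x. cos (\<theta> + (\<Sum>j<n. u j * x j)) \<partial>?D \<pi>) = (\<integral>x. cos (\<theta> + (\<Sum>j<n. u j * x j)) \<partial>?D (\<lambda>j. j))" for \<theta> u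
      unfolding int by (rule trig[OF \<pi>])
  qed simp_all
  then show "?D \<pi> = distr M (Pi\<^sub>M {..<n} (\<lambda>_. borel)) (\<lambda>\<omega>. \<lambda>j\<in>{..<n}. \<zeta> j \<omega>)" .
qed

subsection \<open>Even homogeneous functions\<close>

text \<open>Both sides arise as the derivative of \<open>\<integral>\<bar>\<Sum>j\<in>I. u j * X j\<bar>\<close> in the direction of the \<open>i\<close>-th coordinate.\<close>

lemma abs_moments_half_space:
  fixes X :: "'i \<Rightarrow> 'a \<Rightarrow> real" and Y :: "'i \<Rightarrow> 'b \<Rightarrow> real"
  assumes I: "finite I" "i \<in> I"
    and X: "\<And>j. j \<in> I \<Longrightarrow> integrable M (X j)" and Y: "\<And>j. j \<in> I \<Longrightarrow> integrable M' (Y j)"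
    and eq: "\<And>u. (\<integral>\<omega>. \<bar>\<Sum>j\<in>I. u j * X j \<omega>\<bar> \<partial>M) = (\<integral>\<omega>. \<bar>\<Sum>j\<in>I. u j * Y j \<omega>\<bar> \<partial>M')"
  shows "(\<integral>\<omega>. \<bar>X i \<omega>\<bar> * indicator {0..} ((\<Sum>j\<in>I. u j * X j \<omega>) * X i \<omega>) \<partial>M) =
    (\<integral>\<omega>. \<bar>Y i \<omega>\<bar> * indicator {0..} ((\<Sum>j\<in>I. u j * Y j \<omega>) * Y i \<omega>) \<partial>M')"
proof -
  \<comment> \<open>Positive step sizes tending to 0. The sign matters: at a zero of the sum only
    the one-sided derivative exists in general.\<close>
  define h :: "nat \<Rightarrow> real" where "h m = inverse (real (Suc m))" for m
  have h: "h m > 0" for m by (simp add: h_def)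
  have h0: "h \<longlonglongrightarrow> 0" unfolding h_def by (rule LIMSEQ_inverse_real_of_nat)
  define v :: "real \<Rightarrow> 'i \<Rightarrow> real" where "v t j = u j + (if j = i then t else 0)" for t j
  have v: "(\<Sum>j\<in>I. v t j * x j) = (\<Sum>j\<in>I. u j * x j) + t * x i" for t x
  proof -
    have "(\<Sum>j\<in>I. v t j * x j) = (\<Sum>j\<in>I. u j * x j + (if j = i then t * x i else 0))"
      by (intro sum.cong) (auto simp: v_def algebra_simps)
    then show ?thesis using I by (simp add: sum.distrib)
  qed
  have lim: "(\<lambda>m. ((\<integral>\<omega>. \<bar>\<Sum>j\<in>I. v (h m) j * Z j \<omega>\<bar> \<partial>N) - (\<integral>\<omega>. \<bar>\<Sum>j\<in>I. v 0 j * Z j \<omega>\<bar> \<partial>N)) / h m) \<longlonglongrightarrow>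
     2 * (\<integral>\<omega>. \<bar>Z i \<omega>\<bar> * indicator {0..} ((\<Sum>j\<in>I. u j * Z j \<omega>) * Z i \<omega>) \<partial>N) - (\<integral>\<omega>. \<bar>Z i \<omega>\<bar> \<partial>N)"
    if Z: "\<And>j. j \<in> I \<Longrightarrow> integrable N (Z j)" for N :: "'c measure" and Z
  proof -
    define S where "S \<omega> = (\<Sum>j\<in>I. u j * Z j \<omega>)" for \<omega>
    have [measurable]: "Z j \<in> borel_measurable N" if "j \<in> I" for j using Z[OF that] by simp
    have Zi[measurable]: "Z i \<in> borel_measurable N" using I by simp
    have iS: "integrable N (\<lambda>\<omega>. S \<omega> + t * Z i \<omega>)" for t
      unfolding S_def using Z I by auto
    have [measurable]: "S \<in> borel_measurable N"
      using borel_measurable_integrable[OF iS[of 0]] by simp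
    \<comment> \<open>The right derivative of \<open>\<bar>S + t * z\<bar>\<close> at
      \<open>t = 0\<close> is \<open>sgn S * z\<close> if \<open>S\<close> is non-zero and
      \<open>\<bar>z\<bar>\<close> otherwise. Both are \<open>\<bar>z\<bar>\<close> times the sign
      +1 on the closed half-line \<open>S * z \<ge> 0\<close> and -1 off it.\<close>
    have conv: "(\<lambda>m. (\<bar>S \<omega> + h m * Z i \<omega>\<bar> - \<bar>S \<omega>\<bar>) / h m) \<longlonglongrightarrow> \<bar>Z i \<omega>\<bar> * (2 * indicator {0..} (S \<omega> * Z i \<omega>) - 1)" for \<omega>
    proof (cases "S \<omega> = 0")
      case True
      have "\<bar>h m * Z i \<omega>\<bar> / h m = \<bar>Z i \<omega>\<bar>" for m
        using h[of m] by (simp add: abs_mult)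
      then show ?thesis using True by (simp add: indicator_def)
    next
      case False
      have "(\<lambda>m. h m * Z i \<omega>) \<longlonglongrightarrow> 0 * Z i \<omega>" by (intro tendsto_intros h0)
      then have "eventually (\<lambda>m. \<bar>h m * Z i \<omega>\<bar> < \<bar>S \<omega>\<bar>) sequentially"
        using False by (auto simp: tendsto_iff dist_real_def dest!: spec[of _ "\<bar>S \<omega>\<bar>"])
      then have "eventually (\<lambda>m. (\<bar>S \<omega> + h m * Z i \<omega>\<bar> - \<bar>S \<omega>\<bar>) / h m = \<bar>Z i \<omega>\<bar> * (2 * indicator {0..} (S \<omega> * Z i \<omega>) - 1)) sequentially"
      proof eventually_elim
        case (elim m)
        have "\<bar>S \<omega> + h m * Z i \<omega>\<bar> - \<bar>S \<omega>\<bar> = sgn (S \<omega>) * Z i \<omega> * h m"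
          using elim by (cases "S \<omega> > 0") (auto simp: abs_if sgn_if split: if_splits)
        moreover have "sgn (S \<omega>) * Z i \<omega> = \<bar>Z i \<omega>\<bar> * (2 * indicator {0..} (S \<omega> * Z i \<omega>) - 1)"
          using False by (auto simp: indicator_def zero_le_mult_iff sgn_if)
        ultimately show ?case using h[of m] by simp
      qed
      then show ?thesis by (rule tendsto_eventually)
    qed
    have bound: "norm ((\<bar>S \<omega> + h m * Z i \<omega>\<bar> - \<bar>S \<omega>\<bar>) / h m) \<le> \<bar>Z i \<omega>\<bar>" for \<omega> m
    proof -
      have "\<bar>\<bar>S \<omega> + h m * Z i \<omega>\<bar> - \<bar>S \<omega>\<bar>\<bar> \<le> h m * \<bar>Z i \<omega>\<bar>"
        using abs_triangle_ineq3[of "S \<omega> + h m * Z i \<omega>" "S \<omega>"] h[of m] by (simp add: abs_mult)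
      then show ?thesis using h[of m] by (simp add: abs_divide divide_le_eq mult.commute)
    qed
    have "(\<lambda>m. \<integral>\<omega>. (\<bar>S \<omega> + h m * Z i \<omega>\<bar> - \<bar>S \<omega>\<bar>) / h m \<partial>N) \<longlonglongrightarrow> (\<integral>\<omega>. \<bar>Z i \<omega>\<bar> * (2 * indicator {0..} (S \<omega> * Z i \<omega>) - 1) \<partial>N)"
      by (rule integral_dominated_convergence[where w="\<lambda>\<omega>. \<bar>Z i \<omega>\<bar>"])
        (use conv bound Z I in auto)
    moreover have "(\<integral>\<omega>. (\<bar>S \<omega> + h m * Z i \<omega>\<bar> - \<bar>S \<omega>\<bar>) / h m \<partial>N) =
        ((\<integral>\<omega>. \<bar>S \<omega> + h m * Z i \<omega>\<bar> \<partial>N) - (\<integral>\<omega>. \<bar>S \<omega> + 0 * Z i \<omega>\<bar> \<partial>N)) / h m" for m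
      using integrable_abs[OF iS[of "h m"]] integrable_abs[OF iS[of 0]] by simp
    moreover have "(\<integral>\<omega>. \<bar>Z i \<omega>\<bar> * (2 * indicator {0..} (S \<omega> * Z i \<omega>) - 1) \<partial>N) =
        2 * (\<integral>\<omega>. \<bar>Z i \<omega>\<bar> * indicator {0..} (S \<omega> * Z i \<omega>) \<partial>N) - (\<integral>\<omega>. \<bar>Z i \<omega>\<bar> \<partial>N)"
    proof -
      have a: "integrable N (\<lambda>\<omega>. \<bar>Z i \<omega>\<bar>)" using Z I by auto
      have b: "integrable N (\<lambda>\<omega>. \<bar>Z i \<omega>\<bar> * indicator {0..} (S \<omega> * Z i \<omega>))"
        by (rule Bochner_Integration.integrable_bound[OF a]) (auto simp: indicator_def)
      have "(\<integral>\<omega>. \<bar>Z i \<omega>\<bar> * (2 * indicator {0..} (S \<omega> * Z i \<omega>) - 1) \<partial>N) =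
        (\<integral>\<omega>. 2 * (\<bar>Z i \<omega>\<bar> * indicator {0..} (S \<omega> * Z i \<omega>)) - \<bar>Z i \<omega>\<bar> \<partial>N)"
        by (simp add: algebra_simps)
      then show ?thesis using a b by simp
    qed
    ultimately show ?thesis by (simp only: v S_def[symmetric])
  qed
  \<comment> \<open>The hypothesis for the \<open>i\<close>-th unit vector; it cancels the constant
    term of the derivative.\<close>
  have abs_eq: "(\<integral>\<omega>. \<bar>X i \<omega>\<bar> \<partial>M) = (\<integral>\<omega>. \<bar>Y i \<omega>\<bar> \<partial>M')"
  proof -
    have "(\<Sum>j\<in>I. (if j = i then 1 else 0) * x j) = x i" for x :: "'i \<Rightarrow> real"
      using I by (simp add: if_distrib[of "\<lambda>a. a * _"] cong: if_cong)
    then show ?thesis using eq[of "\<lambda>j. if j = i then 1 else 0"] by simp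
  qed
  have "2 * (\<integral>\<omega>. \<bar>X i \<omega>\<bar> * indicator {0..} ((\<Sum>j\<in>I. u j * X j \<omega>) * X i \<omega>) \<partial>M) - (\<integral>\<omega>. \<bar>X i \<omega>\<bar> \<partial>M) =
    2 * (\<integral>\<omega>. \<bar>Y i \<omega>\<bar> * indicator {0..} ((\<Sum>j\<in>I. u j * Y j \<omega>) * Y i \<omega>) \<partial>M') - (\<integral>\<omega>. \<bar>Y i \<omega>\<bar> \<partial>M')"
    using lim[of M X, OF X] lim[of M' Y, OF Y] unfolding eq by (rule LIMSEQ_unique)
  then show ?thesis using abs_eq by simp
qed

section \<open>Laws of ratios and the Cramer-Wold argument\<close>

text \<open>The density vanishes where \<open>X i\<close> does, so the value of the quotients there
  is immaterial. The \<open>i\<close>-th coordinate is kept; it equals 1 almost everywhere under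
  this law.\<close>

definition projective_law :: "'i set \<Rightarrow> 'a measure \<Rightarrow> ('i \<Rightarrow> 'a \<Rightarrow> real) \<Rightarrow> 'i \<Rightarrow> ('i \<Rightarrow> real) measure" where
  "projective_law I M X i =
     distr (density M (\<lambda>\<omega>. ennreal \<bar>X i \<omega>\<bar>)) (Pi\<^sub>M I (\<lambda>_. borel)) (\<lambda>\<omega>. \<lambda>j\<in>I. X j \<omega> / X i \<omega>)"

lemma sets_projective_law[simp, measurable_cong]:
  "sets (projective_law I M X i) = sets (Pi\<^sub>M I (\<lambda>_. borel))"
  by (simp add: projective_law_def)

lemma nn_integral_projective_law:
  assumes [measurable]: "\<And>j. j \<in> I \<Longrightarrow> X j \<in> borel_measurable M" "i \<in> I"
    and [measurable]: "f \<in> borel_measurable (Pi\<^sub>M I (\<lambda>_. borel))"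
  shows "(\<integral>\<^sup>+x. f x \<partial>projective_law I M X i) =
    (\<integral>\<^sup>+\<omega>. ennreal \<bar>X i \<omega>\<bar> * f (\<lambda>j\<in>I. X j \<omega> / X i \<omega>) \<partial>M)"
proof -
  have [measurable]: "(\<lambda>\<omega>. \<lambda>j\<in>I. X j \<omega> / X i \<omega>) \<in> measurable M (Pi\<^sub>M I (\<lambda>_. borel))"
    by (intro measurable_restrict) measurable
  show ?thesis
    unfolding projective_law_def by (subst nn_integral_distr) (auto simp: nn_integral_density)
qed

lemma finite_measure_projective_law:
  assumes X: "\<And>j. j \<in> I \<Longrightarrow> integrable M (X j)" and i: "i \<in> I"
  shows "finite_measure (projective_law I M X i)"
proof (rule finite_measureI)
  have "emeasure (projective_law I M X i) (space (projective_law I M X i)) = (\<integral>\<^sup>+x. 1 \<partial>projective_law I M X i)"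
    by simp
  also have "\<dots> = (\<integral>\<^sup>+\<omega>. ennreal \<bar>X i \<omega>\<bar> \<partial>M)"
    using X i by (subst nn_integral_projective_law) auto
  also have "\<dots> < \<infinity>"
    using X[OF i] by (subst nn_integral_eq_integral) auto
  finally show "emeasure (projective_law I M X i) (space (projective_law I M X i)) \<noteq> \<infinity>" by simp
qed

text \<open>Cramer-Wold: the half-space \<open>(\<Sum>j\<in>I. u j * x j) \<le> c\<close> has the
  mass given by \<open>abs_moments_half_space\<close> for the coefficients \<open>c - u i\<close> at
  \<open>i\<close> and \<open>- u j\<close> elsewhere. Hence all linear functionals have equal
  distribution functions, therefore equal laws, and their cosine integrals determine the joint
  law.\<close>

lemma projective_law_eqI:
  fixes X :: "'i \<Rightarrow> 'a \<Rightarrow> real" and Y :: "'i \<Rightarrow> 'b \<Rightarrow> real"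
  assumes I: "finite I" "i \<in> I"
    and X: "\<And>j. j \<in> I \<Longrightarrow> integrable M (X j)" and Y: "\<And>j. j \<in> I \<Longrightarrow> integrable M' (Y j)"
    and eq: "\<And>u. (\<integral>\<omega>. \<bar>\<Sum>j\<in>I. u j * X j \<omega>\<bar> \<partial>M) = (\<integral>\<omega>. \<bar>\<Sum>j\<in>I. u j * Y j \<omega>\<bar> \<partial>M')"
  shows "projective_law I M X i = projective_law I M' Y i"
proof -
  let ?L = "\<lambda>(u :: 'i \<Rightarrow> real) x. \<Sum>j\<in>I. u j * x j"
  have L_meas[measurable]: "?L u \<in> borel_measurable (Pi\<^sub>M I (\<lambda>_. borel))" for u
    by (intro borel_measurable_sum borel_measurable_times) auto
  note fin = finite_measure_projective_law[of I M X, OF X I(2)] finite_measure_projective_law[of I M' Y, OF Y I(2)]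
  have cdf: "emeasure (projective_law I N Z i) {x \<in> space (Pi\<^sub>M I (\<lambda>_. borel)). ?L u x \<le> c} =
      ennreal (\<integral>\<omega>. \<bar>Z i \<omega>\<bar> * indicator {0..} ((\<Sum>j\<in>I. ((if j = i then c else 0) - u j) * Z j \<omega>) * Z i \<omega>) \<partial>N)"
    if Z: "\<And>j. j \<in> I \<Longrightarrow> integrable N (Z j)" for N :: "'c measure" and Z u c
  proof -
    have [measurable]: "Z j \<in> borel_measurable N" if "j \<in> I" for j using Z[OF that] by simp
    have [measurable]: "Z i \<in> borel_measurable N" using I by simp
    define A where "A = {x \<in> space (Pi\<^sub>M I (\<lambda>_. borel)). ?L u x \<le> c}"
    have [measurable]: "A \<in> sets (Pi\<^sub>M I (\<lambda>_. borel))" unfolding A_def by measurable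
    have S: "(\<Sum>j\<in>I. ((if j = i then c else 0) - u j) * Z j \<omega>) = c * Z i \<omega> - (\<Sum>j\<in>I. u j * Z j \<omega>)" for \<omega>
    proof -
      have "(\<Sum>j\<in>I. ((if j = i then c else 0) - u j) * Z j \<omega>) = (\<Sum>j\<in>I. (if j = i then c * Z i \<omega> else 0) - u j * Z j \<omega>)"
        by (intro sum.cong) (auto simp: algebra_simps)
      then show ?thesis using I by (simp add: sum_subtractf)
    qed
    \<comment> \<open>The inequality is multiplied by the square of \<open>Z i \<omega>\<close>, so
      the sign of \<open>Z i \<omega>\<close> does not matter.\<close>
    have iff: "?L u (\<lambda>j\<in>I. Z j \<omega> / Z i \<omega>) \<le> c \<longleftrightarrow> 0 \<le> (c * Z i \<omega> - (\<Sum>j\<in>I. u j * Z j \<omega>)) * Z i \<omega>" if "Z i \<omega> \<noteq> 0" for \<omega>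
    proof -
      have "?L u (\<lambda>j\<in>I. Z j \<omega> / Z i \<omega>) = (\<Sum>j\<in>I. u j * Z j \<omega>) / Z i \<omega>"
        by (simp add: sum_divide_distrib)
      moreover have "(c * Z i \<omega> - (\<Sum>j\<in>I. u j * Z j \<omega>)) * Z i \<omega> = (c - (\<Sum>j\<in>I. u j * Z j \<omega>) / Z i \<omega>) * (Z i \<omega>)\<^sup>2"
        using that by (simp add: field_simps power2_eq_square)
      ultimately show ?thesis
        using that by (simp add: zero_le_mult_iff)
    qed
    have "emeasure (projective_law I N Z i) A = (\<integral>\<^sup>+x. indicator A x \<partial>projective_law I N Z i)"
      by simp
    also have "\<dots> = (\<integral>\<^sup>+\<omega>. ennreal \<bar>Z i \<omega>\<bar> * indicator A (\<lambda>j\<in>I. Z j \<omega> / Z i \<omega>) \<partial>N)"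
      using I by (intro nn_integral_projective_law) auto
    also have "\<dots> = (\<integral>\<^sup>+\<omega>. ennreal (\<bar>Z i \<omega>\<bar> * indicator {0..} ((\<Sum>j\<in>I. ((if j = i then c else 0) - u j) * Z j \<omega>) * Z i \<omega>)) \<partial>N)"
    proof (intro nn_integral_cong)
      fix \<omega>
      show "ennreal \<bar>Z i \<omega>\<bar> * indicator A (\<lambda>j\<in>I. Z j \<omega> / Z i \<omega>) =
        ennreal (\<bar>Z i \<omega>\<bar> * indicator {0..} ((\<Sum>j\<in>I. ((if j = i then c else 0) - u j) * Z j \<omega>) * Z i \<omega>))"
        using iff[of \<omega>] unfolding S A_def
        by (cases "Z i \<omega> = 0") (auto simp: indicator_def space_PiM)
    qed
    also have "\<dots> = ennreal (\<integral>\<omega>. \<bar>Z i \<omega>\<bar> * indicator {0..} ((\<Sum>j\<in>I. ((if j = i then c else 0) - u j) * Z j \<omega>) * Z i \<omega>) \<partial>N)"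
    proof (rule nn_integral_eq_integral)
      show "integrable N (\<lambda>\<omega>. \<bar>Z i \<omega>\<bar> * indicator {0..} ((\<Sum>j\<in>I. ((if j = i then c else 0) - u j) * Z j \<omega>) * Z i \<omega>))"
        by (rule Bochner_Integration.integrable_bound[OF integrable_abs[OF Z[OF I(2)]]]) (auto simp: indicator_def)
    qed auto
    finally show ?thesis unfolding A_def .
  qed
  have law: "distr (projective_law I M X i) borel (?L u) = distr (projective_law I M' Y i) borel (?L u)" for u
  proof (rule cdf_unique')
    have f: "finite_borel_measure (distr (projective_law I N Z i) borel (?L u))"
      if "finite_measure (projective_law I N Z i)" for N :: "'c measure" and Z
    proof -
      interpret finite_measure "projective_law I N Z i" by fact
      interpret D: finite_measure "distr (projective_law I N Z i) borel (?L u)"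
        by (rule finite_measure_distr) measurable
      show ?thesis by unfold_locales auto
    qed
    show "finite_borel_measure (distr (projective_law I M X i) borel (?L u))" "finite_borel_measure (distr (projective_law I M' Y i) borel (?L u))"
      using f fin by auto
    have v: "?L u -` {..c} \<inter> space (projective_law I N Z i) = {x \<in> space (Pi\<^sub>M I (\<lambda>_. borel)). ?L u x \<le> c}" for c and N :: "'c measure" and Z
      by (auto simp: sets_eq_imp_space_eq[OF sets_projective_law])
    have "emeasure (distr (projective_law I M X i) borel (?L u)) {..c} = emeasure (distr (projective_law I M' Y i) borel (?L u)) {..c}" for c
      using abs_moments_half_space[OF I X Y eq, of "\<lambda>j. (if j = i then c else 0) - u j"]
      by (simp add: emeasure_distr v cdf[of M X, OF X] cdf[of M' Y, OF Y])
    then show "cdf (distr (projective_law I M X i) borel (?L u)) = cdf (distr (projective_law I M' Y i) borel (?L u))"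
      by (simp add: fun_eq_iff cdf_def measure_def)
  qed
  show ?thesis
  proof (rule PiM_measure_eqI_trig[OF I(1) fin])
    fix \<theta> u
    have t: "(\<integral>x. cos (\<theta> + ?L u x) \<partial>projective_law I N Z i) = (\<integral>y. cos (\<theta> + y) \<partial>distr (projective_law I N Z i) borel (?L u))"
      for N :: "'c measure" and Z
      by (subst integral_distr) auto
    show "(\<integral>x. cos (\<theta> + ?L u x) \<partial>projective_law I M X i) = (\<integral>x. cos (\<theta> + ?L u x) \<partial>projective_law I M' Y i)"
      unfolding t law ..
  qed auto
qed

text \<open>With \<open>S x = (\<Sum>j\<in>I. \<bar>x j\<bar>)\<close>, write \<open>f X\<close> as the sum of \<open>\<bar>X i\<bar> * (f / S) (X / X i)\<close> over \<open>i\<close>.\<close>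

lemma abs_moments_determine_even_homogeneous:
  fixes X :: "'i \<Rightarrow> 'a \<Rightarrow> real" and Y :: "'i \<Rightarrow> 'b \<Rightarrow> real" and f :: "('i \<Rightarrow> real) \<Rightarrow> real"
  assumes I: "finite I"
    and X: "\<And>j. j \<in> I \<Longrightarrow> integrable M (X j)" and Y: "\<And>j. j \<in> I \<Longrightarrow> integrable M' (Y j)"
    and eq: "\<And>u. (\<integral>\<omega>. \<bar>\<Sum>j\<in>I. u j * X j \<omega>\<bar> \<partial>M) = (\<integral>\<omega>. \<bar>\<Sum>j\<in>I. u j * Y j \<omega>\<bar> \<partial>M')"
    and f[measurable]: "f \<in> borel_measurable (Pi\<^sub>M I (\<lambda>_. borel))"
    and nonneg: "\<And>x. 0 \<le> f x"
    and hom: "\<And>c x. f (\<lambda>j\<in>I. c * x j) = \<bar>c\<bar> * f (\<lambda>j\<in>I. x j)"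
  shows "(\<integral>\<^sup>+\<omega>. ennreal (f (\<lambda>j\<in>I. X j \<omega>)) \<partial>M) = (\<integral>\<^sup>+\<omega>. ennreal (f (\<lambda>j\<in>I. Y j \<omega>)) \<partial>M')"
proof -
  define S :: "('i \<Rightarrow> real) \<Rightarrow> real" where "S x = (\<Sum>j\<in>I. \<bar>x j\<bar>)" for x
  have [measurable]: "S \<in> borel_measurable (Pi\<^sub>M I (\<lambda>_. borel))"
    unfolding S_def by (intro borel_measurable_sum borel_measurable_abs) auto
  have S0: "S x \<ge> 0" for x unfolding S_def by (intro sum_nonneg) auto
  have *: "(\<integral>\<^sup>+\<omega>. ennreal (f (\<lambda>j\<in>I. Z j \<omega>)) \<partial>N) = (\<Sum>i\<in>I. \<integral>\<^sup>+x. ennreal (f x / S x) \<partial>projective_law I N Z i)"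
    if Z: "\<And>j. j \<in> I \<Longrightarrow> integrable N (Z j)" for N :: "'c measure" and Z
  proof -
    have [measurable]: "Z j \<in> borel_measurable N" if "j \<in> I" for j using Z[OF that] by simp
    have [measurable]: "(\<lambda>\<omega>. \<lambda>j\<in>I. Z j \<omega>) \<in> measurable N (Pi\<^sub>M I (\<lambda>_. borel))"
      by (intro measurable_restrict) auto
    have "(\<integral>\<^sup>+x. ennreal (f x / S x) \<partial>projective_law I N Z i) =
      (\<integral>\<^sup>+\<omega>. ennreal (\<bar>Z i \<omega>\<bar> * (f (\<lambda>j\<in>I. Z j \<omega>) / S (\<lambda>j\<in>I. Z j \<omega>))) \<partial>N)" if i: "i \<in> I" for i
    proof (subst nn_integral_projective_law)
      show "(\<integral>\<^sup>+\<omega>. ennreal \<bar>Z i \<omega>\<bar> * ennreal (f (\<lambda>j\<in>I. Z j \<omega> / Z i \<omega>) / S (\<lambda>j\<in>I. Z j \<omega> / Z i \<omega>)) \<partial>N) =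
        (\<integral>\<^sup>+\<omega>. ennreal (\<bar>Z i \<omega>\<bar> * (f (\<lambda>j\<in>I. Z j \<omega>) / S (\<lambda>j\<in>I. Z j \<omega>))) \<partial>N)"
      proof (intro nn_integral_cong)
        fix \<omega>
        show "ennreal \<bar>Z i \<omega>\<bar> * ennreal (f (\<lambda>j\<in>I. Z j \<omega> / Z i \<omega>) / S (\<lambda>j\<in>I. Z j \<omega> / Z i \<omega>)) =
          ennreal (\<bar>Z i \<omega>\<bar> * (f (\<lambda>j\<in>I. Z j \<omega>) / S (\<lambda>j\<in>I. Z j \<omega>)))"
        proof (cases "Z i \<omega> = 0")
          case False
          \<comment> \<open>The factor \<open>1 / Z i \<omega>\<close> may be negative: homogeneity
            with \<open>\<bar>c\<bar>\<close> includes evenness. The same factor appears in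
            \<open>S\<close>, so it cancels in \<open>f / S\<close>.\<close>
          have "f (\<lambda>j\<in>I. Z j \<omega> / Z i \<omega>) = f (\<lambda>j\<in>I. Z j \<omega>) / \<bar>Z i \<omega>\<bar>"
            using hom[of "1 / Z i \<omega>" "\<lambda>j. Z j \<omega>"] by simp
          moreover have "S (\<lambda>j\<in>I. Z j \<omega> / Z i \<omega>) = S (\<lambda>j\<in>I. Z j \<omega>) / \<bar>Z i \<omega>\<bar>"
            by (simp add: S_def sum_divide_distrib abs_divide)
          ultimately show ?thesis
            using False S0 nonneg by (subst ennreal_mult[symmetric]) auto
        qed simp
      qed
    qed (use i in auto)
    then have "(\<Sum>i\<in>I. \<integral>\<^sup>+x. ennreal (f x / S x) \<partial>projective_law I N Z i) =
      (\<Sum>i\<in>I. \<integral>\<^sup>+\<omega>. ennreal (\<bar>Z i \<omega>\<bar> * (f (\<lambda>j\<in>I. Z j \<omega>) / S (\<lambda>j\<in>I. Z j \<omega>))) \<partial>N)"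
      by simp
    also have "\<dots> = (\<integral>\<^sup>+\<omega>. (\<Sum>i\<in>I. ennreal (\<bar>Z i \<omega>\<bar> * (f (\<lambda>j\<in>I. Z j \<omega>) / S (\<lambda>j\<in>I. Z j \<omega>)))) \<partial>N)"
      by (rule nn_integral_sum[symmetric]) measurable
    also have "\<dots> = (\<integral>\<^sup>+\<omega>. ennreal (f (\<lambda>j\<in>I. Z j \<omega>)) \<partial>N)"
    proof (intro nn_integral_cong)
      fix \<omega>
      let ?z = "\<lambda>j\<in>I. Z j \<omega>"
      have "(\<Sum>i\<in>I. \<bar>Z i \<omega>\<bar> * (f ?z / S ?z)) = (\<Sum>i\<in>I. \<bar>Z i \<omega>\<bar>) * (f ?z / S ?z)"
        by (rule sum_distrib_right[symmetric])
      also have "(\<Sum>i\<in>I. \<bar>Z i \<omega>\<bar>) = S ?z" by (simp add: S_def)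
      also have "S ?z * (f ?z / S ?z) = f ?z"
      \<comment> \<open>If \<open>S\<close> vanishes, the vector is zero, and \<open>f\<close>
        vanishes there by homogeneity with factor 0, which agrees with division by zero yielding
        0.\<close>
      proof (cases "S ?z = 0")
        case True
        then have "Z j \<omega> = 0" if "j \<in> I" for j
          using that I by (simp add: S_def sum_nonneg_eq_0_iff)
        then have "?z = (\<lambda>j\<in>I. 0 * (0::real))" by auto
        then have "f ?z = 0" using hom[of 0 "\<lambda>_. 0"] by simp
        then show ?thesis by simp
      qed simp
      finally have "(\<Sum>i\<in>I. \<bar>Z i \<omega>\<bar> * (f ?z / S ?z)) = f ?z" .
      moreover have "(\<Sum>i\<in>I. ennreal (\<bar>Z i \<omega>\<bar> * (f ?z / S ?z))) = ennreal (\<Sum>i\<in>I. \<bar>Z i \<omega>\<bar> * (f ?z / S ?z))"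
        by (rule sum_ennreal) (intro mult_nonneg_nonneg divide_nonneg_nonneg S0 nonneg abs_ge_zero)
      ultimately show "(\<Sum>i\<in>I. ennreal (\<bar>Z i \<omega>\<bar> * (f ?z / S ?z))) = ennreal (f ?z)"
        by (simp only:)
    qed
    finally show ?thesis ..
  qed
  show ?thesis
    using *[of M X, OF X] *[of M' Y, OF Y] projective_law_eqI[OF I _ X Y eq] by simp
qed

subsection \<open>Partial norms\<close>

lemma partial_norm_cong:
  "(\<And>j. j < n \<Longrightarrow> x j = y j) \<Longrightarrow> partial_norm p n x = partial_norm p n y"
  unfolding partial_norm_def by (auto intro!: arg_cong[where f=Max] image_cong sum.cong arg_cong2[where f="(powr)"] arg_cong2[where f="(/)"])

lemma borel_measurable_partial_norm[measurable (raw)]: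
  assumes [measurable]: "\<And>j. j < n \<Longrightarrow> X j \<in> borel_measurable M"
  shows "(\<lambda>\<omega>. partial_norm p n (\<lambda>j. X j \<omega>)) \<in> borel_measurable M"
  unfolding partial_norm_def by measurable

lemma partial_norm_nonneg: "1 \<le> n \<Longrightarrow> 0 \<le> partial_norm p n x"
  unfolding partial_norm_def by (auto simp: Max_ge_iff lessThan_empty_iff intro!: exI[of _ "0::nat"])

lemma ereal_ge_1_cases:
  fixes p :: ereal
  assumes "1 \<le> p"
  obtains "p = \<infinity>" | q where "p = ereal q" "1 \<le> q"
  using assms by (cases p) auto

lemma partial_norm_cmult:
  assumes p: "1 \<le> p" and n: "1 \<le> n"
  shows "partial_norm p n (\<lambda>j. c * x j) = \<bar>c\<bar> * partial_norm p n x"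
  using p
proof (cases rule: ereal_ge_1_cases)
  case 1
  have "mono (\<lambda>y. \<bar>c\<bar> * y)" by (auto intro!: monoI mult_left_mono)
  then have "\<bar>c\<bar> * Max ((\<lambda>j. \<bar>x j\<bar>) ` {..<n}) = Max ((\<lambda>y. \<bar>c\<bar> * y) ` (\<lambda>j. \<bar>x j\<bar>) ` {..<n})"
    using n by (intro mono_Max_commute) (auto simp: lessThan_empty_iff)
  then show ?thesis using 1 by (simp add: partial_norm_def abs_mult image_image)
next
  case (2 q)
  have "(\<Sum>j<n. \<bar>c * x j\<bar> powr q) / real n = \<bar>c\<bar> powr q * ((\<Sum>j<n. \<bar>x j\<bar> powr q) / real n)"
    by (simp add: abs_mult powr_mult sum_distrib_left)
  then have "((\<Sum>j<n. \<bar>c * x j\<bar> powr q) / real n) powr (1 / q) = (\<bar>c\<bar> powr q) powr (1 / q) * ((\<Sum>j<n. \<bar>x j\<bar> powr q) / real n) powr (1 / q)"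
    by (simp only: powr_mult)
  then show ?thesis using 2 by (simp add: partial_norm_def powr_powr)
qed

lemma partial_norm_permute:
  assumes "\<pi> permutes {..<n}"
  shows "partial_norm p n (\<lambda>j. x (\<pi> j)) = partial_norm p n x"
proof -
  have "(\<lambda>j. \<bar>x (\<pi> j)\<bar>) ` {..<n} = (\<lambda>j. \<bar>x j\<bar>) ` \<pi> ` {..<n}" by (simp add: image_image)
  then show ?thesis
    using sum.permute[OF assms, of "\<lambda>j. \<bar>x j\<bar> powr real_of_ereal p"] permutes_image[OF assms]
    by (simp add: partial_norm_def o_def)
qed

text \<open>Each entry is at most the sum of all absolute values, hence so is any power mean or
  maximum. This crude bound serves to show that the partial norms are integrable.\<close>

lemma partial_norm_le_sum:
  assumes p: "1 \<le> p" and n: "1 \<le> n"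
  shows "partial_norm p n x \<le> (\<Sum>j<n. \<bar>x j\<bar>)"
proof -
  let ?S = "\<Sum>j<n. \<bar>x j\<bar>"
  have le: "\<bar>x j\<bar> \<le> ?S" if "j < n" for j
    using that by (intro member_le_sum) auto
  have S: "0 \<le> ?S" by (intro sum_nonneg) auto
  show ?thesis
    using p
  proof (cases rule: ereal_ge_1_cases)
    case 1
    then show ?thesis using n le by (auto simp: partial_norm_def lessThan_empty_iff)
  next
    case (2 q)
    have "(\<Sum>j<n. \<bar>x j\<bar> powr q) \<le> (\<Sum>j<n. ?S powr q)"
      using 2 le by (intro sum_mono powr_mono2) auto
    then have "(\<Sum>j<n. \<bar>x j\<bar> powr q) / real n \<le> ?S powr q"
      using n by (simp add: divide_le_eq mult.commute)
    then have "((\<Sum>j<n. \<bar>x j\<bar> powr q) / real n) powr (1 / q) \<le> (?S powr q) powr (1 / q)"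
      using 2 by (intro powr_mono2 divide_nonneg_nonneg sum_nonneg) auto
    then show ?thesis using 2 S by (simp add: partial_norm_def powr_powr)
  qed
qed

text \<open>The power mean inequality, for finite exponents obtained from Young's inequality applied
  to the entries divided by the norm \<open>r\<close>. It bounds averages of
  \<open>\<bar>\<xi> j\<bar>\<close> on the event that the limit norm is zero.\<close>

lemma mean_abs_le_partial_norm:
  assumes p: "1 \<le> p" and n: "1 \<le> n"
  shows "(\<Sum>j<n. \<bar>x j\<bar>) / real n \<le> partial_norm p n x"
  using p
proof (cases rule: ereal_ge_1_cases)
  case 1
  have "(\<Sum>j<n. \<bar>x j\<bar>) \<le> (\<Sum>j<n. partial_norm p n x)"
    using 1 by (intro sum_mono) (auto simp: partial_norm_def)
  then show ?thesis using n by (simp add: divide_le_eq mult.commute)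
next
  case (2 q)
  define m where "m = (\<Sum>j<n. \<bar>x j\<bar> powr q) / real n"
  define r where "r = partial_norm p n x"
  have m0: "0 \<le> m" unfolding m_def by (intro divide_nonneg_nonneg sum_nonneg) auto
  have r: "r = m powr (1 / q)" using 2 by (simp add: r_def partial_norm_def m_def)
  have rq: "r powr q = m" using 2 m0 by (simp add: r powr_powr)
  show ?thesis
  proof (cases "m = 0")
    case True
    then have "(\<Sum>j<n. \<bar>x j\<bar> powr q) = 0" using n by (simp add: m_def)
    then have "x j = 0" if "j < n" for j
      using that by (subst (asm) sum_nonneg_eq_0_iff) auto
    then show ?thesis using n by (simp add: partial_norm_nonneg)
  next
    case False
    then have m: "m > 0" using m0 by simp
    then have r0: "r > 0" by (simp add: r)
    \<comment> \<open>Weighted arithmetic-geometric mean of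
      \<open>\<bar>x j\<bar> powr q / m\<close> and 1 with weights \<open>1 / q\<close> and
      \<open>1 - 1 / q\<close>. Summed over \<open>j\<close>, the right-hand side is exactly
      \<open>n\<close>, since the powers sum to \<open>n * m\<close>.\<close>
    have "\<bar>x j\<bar> / r \<le> 1 / q * (\<bar>x j\<bar> powr q / m) + (1 - 1 / q)" for j
    proof (cases "x j = 0")
      case True
      then show ?thesis using 2 by simp
    next
      case False
      then have "(\<bar>x j\<bar> powr q / m) powr (1 / q) * 1 powr (1 - 1 / q) \<le> 1 / q * (\<bar>x j\<bar> powr q / m) + (1 - 1 / q) * 1"
        using 2 m by (intro Youngs_inequality_0) auto
      moreover have "(\<bar>x j\<bar> powr q / m) powr (1 / q) = \<bar>x j\<bar> / r"
        using 2 by (simp add: powr_divide powr_powr r)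
      ultimately show ?thesis by simp
    qed
    then have "(\<Sum>j<n. \<bar>x j\<bar> / r) \<le> (\<Sum>j<n. 1 / q * (\<bar>x j\<bar> powr q / m) + (1 - 1 / q))"
      by (intro sum_mono)
    also have "\<dots> = 1 / q * ((\<Sum>j<n. \<bar>x j\<bar> powr q) / m) + real n * (1 - 1 / q)"
      by (simp add: sum.distrib sum_distrib_left sum_divide_distrib)
    also have "(\<Sum>j<n. \<bar>x j\<bar> powr q) / m = real n"
      using m n by (simp add: m_def field_simps)
    also have "1 / q * real n + real n * (1 - 1 / q) = real n"
      by (simp add: algebra_simps)
    finally show ?thesis
      using r0 n by (simp add: r_def[symmetric] sum_divide_distrib[symmetric] field_simps)
  qed
qed

section \<open>Consequences of swap-invariance\<close>

lemma swap_invariantD: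
  assumes "swap_invariant M \<xi>" "1 \<le> n" "\<pi> permutes {..<n}"
  shows "(\<integral>\<omega>. \<bar>\<Sum>j<n. u j * \<xi> j \<omega>\<bar> \<partial>M) = (\<integral>\<omega>. \<bar>\<Sum>j<n. u j * \<xi> (\<pi> j) \<omega>\<bar> \<partial>M)"
  using assms unfolding swap_invariant_def by blast

text \<open>Swap-invariance equates the absolute moments of all linear combinations of the permuted
  and the original vector, so \<open>abs_moments_determine_even_homogeneous\<close> applies. As
  \<open>f\<close> is non-negative, equality of the non-negative integrals carries over to the
  Bochner integrals, also if they are infinite.\<close>

lemma swap_invariant_even_homogeneous:
  fixes f :: "(nat \<Rightarrow> real) \<Rightarrow> real"
  assumes swap: "swap_invariant M \<xi>" and n: "1 \<le> n" and \<pi>: "\<pi> permutes {..<n}"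
    and "f \<in> borel_measurable (Pi\<^sub>M {..<n} (\<lambda>_. borel))"
    and "\<And>x. 0 \<le> f x"
    and "\<And>c x. f (\<lambda>j\<in>{..<n}. c * x j) = \<bar>c\<bar> * f (\<lambda>j\<in>{..<n}. x j)"
  shows "(\<integral>\<omega>. f (\<lambda>j\<in>{..<n}. \<xi> (\<pi> j) \<omega>) \<partial>M) = (\<integral>\<omega>. f (\<lambda>j\<in>{..<n}. \<xi> j \<omega>) \<partial>M)"
proof -
  have int: "integrable M (\<xi> j)" for j using swap by (simp add: swap_invariant_def)
  have [measurable]: "\<xi> j \<in> borel_measurable M" for j using int[of j] by simp
  note [measurable] = \<open>f \<in> borel_measurable _\<close>
  have m: "(\<lambda>\<omega>. f (\<lambda>j\<in>{..<n}. \<xi> (\<sigma> j) \<omega>)) \<in> borel_measurable M" for \<sigma>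
  proof -
    have [measurable]: "(\<lambda>\<omega>. \<lambda>j\<in>{..<n}. \<xi> (\<sigma> j) \<omega>) \<in> measurable M (Pi\<^sub>M {..<n} (\<lambda>_. borel))"
      by (intro measurable_restrict) auto
    show ?thesis by measurable
  qed
  have "(\<integral>\<^sup>+\<omega>. ennreal (f (\<lambda>j\<in>{..<n}. \<xi> (\<pi> j) \<omega>)) \<partial>M) = (\<integral>\<^sup>+\<omega>. ennreal (f (\<lambda>j\<in>{..<n}. \<xi> j \<omega>)) \<partial>M)"
  proof (rule abs_moments_determine_even_homogeneous)
    show "(\<integral>\<omega>. \<bar>\<Sum>j\<in>{..<n}. u j * \<xi> (\<pi> j) \<omega>\<bar> \<partial>M) = (\<integral>\<omega>. \<bar>\<Sum>j\<in>{..<n}. u j * \<xi> j \<omega>\<bar> \<partial>M)" for u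
      by (rule swap_invariantD[OF swap n \<pi>, symmetric])
  qed (rule finite_lessThan int assms(4-6))+
  then show ?thesis
    using m[of \<pi>] m[of "\<lambda>j. j"] assms(5) by (simp add: integral_eq_nn_integral)
qed

subsection \<open>Random signs\<close>

text \<open>The sigma-algebra generated by \<open>h \<circ> Y\<close> is contained in that of
  \<open>Y\<close>, so \<open>X\<close> and \<open>h \<circ> Y\<close> are independent real
  variables and the product rule for expectations applies.\<close>

lemma (in prob_space) indep_random_variables_integral_mult:
  fixes X :: "'a \<Rightarrow> real" and Y :: "'a \<Rightarrow> 'b" and h :: "'b \<Rightarrow> real"
  assumes ind: "indep_random_variables M borel X T Y"
    and h[measurable]: "h \<in> borel_measurable T"
    and X: "integrable M X" and hY: "integrable M (\<lambda>\<omega>. h (Y \<omega>))"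
  shows "(\<integral>\<omega>. X \<omega> * h (Y \<omega>) \<partial>M) = (\<integral>\<omega>. X \<omega> \<partial>M) * (\<integral>\<omega>. h (Y \<omega>) \<partial>M)"
proof (rule indep_var_lebesgue_integral[OF _ X hY])
  have [measurable]: "X \<in> borel_measurable M" "Y \<in> measurable M T"
    using ind by (auto simp: indep_random_variables_def)
  have sub: "sigma_sets (space M) {(\<lambda>\<omega>. h (Y \<omega>)) -` A \<inter> space M |A. A \<in> sets borel} \<subseteq>
    sigma_sets (space M) {Y -` B \<inter> space M |B. B \<in> sets T}"
  proof (rule sigma_sets_mono', safe)
    fix A :: "real set" assume "A \<in> sets borel"
    then have "h -` A \<inter> space T \<in> sets T" by measurable
    moreover have "(\<lambda>\<omega>. h (Y \<omega>)) -` A \<inter> space M = Y -` (h -` A \<inter> space T) \<inter> space M"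
      using measurable_space[of Y M T] by auto
    ultimately show "\<exists>B. (\<lambda>\<omega>. h (Y \<omega>)) -` A \<inter> space M = Y -` B \<inter> space M \<and> B \<in> sets T" by blast
  qed
  have "indep_set (sigma_sets (space M) {X -` A \<inter> space M |A. A \<in> sets borel})
      (sigma_sets (space M) {(\<lambda>\<omega>. h (Y \<omega>)) -` A \<inter> space M |A. A \<in> sets borel})"
    using ind sub unfolding indep_random_variables_def indep_sets2_eq by blast
  then show "indep_var borel X borel (\<lambda>\<omega>. h (Y \<omega>))"
    unfolding indep_var_eq by simp
qed

lemma (in prob_space) fair_sign:
  fixes \<epsilon> :: "'a \<Rightarrow> real"
  assumes [measurable]: "\<epsilon> \<in> borel_measurable M"
    and half: "prob {\<omega> \<in> space M. \<epsilon> \<omega> = 1} = 1 / 2" "prob {\<omega> \<in> space M. \<epsilon> \<omega> = -1} = 1 / 2"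
  shows "AE \<omega> in M. \<epsilon> \<omega> = 1 \<or> \<epsilon> \<omega> = -1" and "integrable M \<epsilon>" and "(\<integral>\<omega>. \<epsilon> \<omega> \<partial>M) = 0"
proof -
  let ?A = "{\<omega> \<in> space M. \<epsilon> \<omega> = 1}" and ?B = "{\<omega> \<in> space M. \<epsilon> \<omega> = -1}"
  have "prob (?A \<union> ?B) = 1"
    using half by (subst finite_measure_Union) auto
  then have "AE \<omega> in M. \<omega> \<in> ?A \<union> ?B"
    by (subst (asm) prob_eq_1) auto
  then show AE: "AE \<omega> in M. \<epsilon> \<omega> = 1 \<or> \<epsilon> \<omega> = -1" by eventually_elim auto
  then have "AE \<omega> in M. norm (\<epsilon> \<omega>) \<le> 1" by eventually_elim auto
  then show "integrable M \<epsilon>" by (intro integrable_const_bound) auto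
  have "(\<integral>\<omega>. \<epsilon> \<omega> \<partial>M) = (\<integral>\<omega>. indicator ?A \<omega> - indicator ?B \<omega> \<partial>M)"
  proof (rule integral_cong_AE)
    show "AE \<omega> in M. \<epsilon> \<omega> = indicator ?A \<omega> - indicator ?B \<omega>"
      using AE AE_space by eventually_elim (auto simp: indicator_def)
  qed auto
  also have "\<dots> = 0"
    using half by (subst Bochner_Integration.integral_diff) (auto intro!: integrable_real_indicator simp: less_top[symmetric])
  finally show "(\<integral>\<omega>. \<epsilon> \<omega> \<partial>M) = 0" .
qed

subsection \<open>Normalised swap-invariant sequences\<close>

locale convergent_swap_invariant = prob_space P
  for P :: "'a measure" +
  fixes \<xi> :: "nat \<Rightarrow> 'a \<Rightarrow> real" and p :: ereal
  assumes p: "1 \<le> p"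
    and swap: "swap_invariant P \<xi>"
    and conv: "AE \<omega> in P. (\<lambda>n. ereal (partial_norm p n (\<lambda>j. \<xi> j \<omega>))) \<longlonglongrightarrow> limsup_norm p (\<lambda>j. \<xi> j \<omega>)"
    and L1: "tendsto_L1 P (\<lambda>n \<omega>. partial_norm p n (\<lambda>j. \<xi> j \<omega>)) (\<lambda>\<omega>. limsup_norm p (\<lambda>j. \<xi> j \<omega>))"
begin

section \<open>The limit norm and its zero set\<close>

definition r :: "nat \<Rightarrow> 'a \<Rightarrow> real" where "r n \<omega> = partial_norm p n (\<lambda>j. \<xi> j \<omega>)"
definition N :: "'a \<Rightarrow> ereal" where "N \<omega> = limsup_norm p (\<lambda>j. \<xi> j \<omega>)"
text \<open>A real-valued version of \<open>N\<close>, equal to it almost surely; it is 0 on the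
  null set where \<open>N\<close> is infinite.\<close>

definition R :: "'a \<Rightarrow> real" where "R \<omega> = real_of_ereal (N \<omega>)"

lemma xi_integrable: "integrable P (\<xi> j)"
  using swap by (simp add: swap_invariant_def)

lemma xi_measurable[measurable]: "\<xi> j \<in> borel_measurable P"
  using xi_integrable by simp

lemma r_measurable[measurable]: "r n \<in> borel_measurable P"
  unfolding r_def[abs_def] by measurable

lemma N_measurable[measurable]: "N \<in> borel_measurable P"
  unfolding N_def[abs_def] limsup_norm_def by measurable

lemma R_measurable[measurable]: "R \<in> borel_measurable P"
  unfolding R_def[abs_def] by measurable

lemma r_nonneg: "1 \<le> n \<Longrightarrow> 0 \<le> r n \<omega>"
  by (simp add: r_def partial_norm_nonneg)

lemma r_integrable:
  assumes n: "1 \<le> n"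
  shows "integrable P (r n)"
proof (rule Bochner_Integration.integrable_bound)
  show "integrable P (\<lambda>\<omega>. \<Sum>j<n. \<bar>\<xi> j \<omega>\<bar>)"
    by (intro Bochner_Integration.integrable_sum integrable_abs xi_integrable)
  have "norm (r n \<omega>) \<le> norm (\<Sum>j<n. \<bar>\<xi> j \<omega>\<bar>)" for \<omega>
    using partial_norm_le_sum[OF p n, of "\<lambda>j. \<xi> j \<omega>"] r_nonneg[OF n, of \<omega>]
    unfolding r_def by (simp del: abs_sum_abs)
  then show "AE \<omega> in P. norm (r n \<omega>) \<le> norm (\<Sum>j<n. \<bar>\<xi> j \<omega>\<bar>)" by simp
qed simp

lemma N_nonneg: "0 \<le> N \<omega>"
  unfolding N_def limsup_norm_def
  by (rule le_Limsup) (auto simp: eventually_sequentially partial_norm_nonneg intro!: exI[of _ 1])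

lemma R_nonneg: "0 \<le> R \<omega>"
  using N_nonneg by (simp add: R_def real_of_ereal_pos)

text \<open>Some \<open>r n\<close> has finite expected distance to \<open>N\<close> and is itself
  integrable; the bound of \<open>N\<close> by \<open>r n\<close> plus the distance remains valid
  where \<open>N\<close> is infinite.\<close>

lemma nn_integral_N_finite: "(\<integral>\<^sup>+\<omega>. e2ennreal (N \<omega>) \<partial>P) < \<infinity>"
proof -
  have "eventually (\<lambda>n. (\<integral>\<^sup>+\<omega>. e2ennreal \<bar>ereal (r n \<omega>) - N \<omega>\<bar> \<partial>P) < 1) sequentially"
    using order_tendstoD(2)[OF L1[unfolded tendsto_L1_def], of 1] by (simp add: r_def N_def)
  then obtain n0 where "\<And>n. n0 \<le> n \<Longrightarrow> (\<integral>\<^sup>+\<omega>. e2ennreal \<bar>ereal (r n \<omega>) - N \<omega>\<bar> \<partial>P) < 1"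
    unfolding eventually_sequentially by blast
  \<comment> \<open>The successor ensures \<open>1 \<le> n\<close>, so that \<open>r n\<close> is
    non-negative and integrable.\<close>
  from this[of "Suc n0"] obtain n where n: "1 \<le> n" "(\<integral>\<^sup>+\<omega>. e2ennreal \<bar>ereal (r n \<omega>) - N \<omega>\<bar> \<partial>P) < 1"
    using that[of "Suc n0"] by simp
  have "e2ennreal (N \<omega>) \<le> ennreal (r n \<omega>) + e2ennreal \<bar>ereal (r n \<omega>) - N \<omega>\<bar>" for \<omega>
  proof (cases "N \<omega>")
    case (real a)
    have "ennreal a \<le> ennreal (r n \<omega> + \<bar>r n \<omega> - a\<bar>)" by (rule ennreal_leI) linarith
    then show ?thesis using real r_nonneg[OF n(1), of \<omega>] by (simp add: ennreal_plus)
  qed (use N_nonneg[of \<omega>] in simp_all)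
  then have "(\<integral>\<^sup>+\<omega>. e2ennreal (N \<omega>) \<partial>P) \<le> (\<integral>\<^sup>+\<omega>. ennreal (r n \<omega>) + e2ennreal \<bar>ereal (r n \<omega>) - N \<omega>\<bar> \<partial>P)"
    by (intro nn_integral_mono)
  also have "\<dots> = (\<integral>\<^sup>+\<omega>. ennreal (r n \<omega>) \<partial>P) + (\<integral>\<^sup>+\<omega>. e2ennreal \<bar>ereal (r n \<omega>) - N \<omega>\<bar> \<partial>P)"
    by (intro nn_integral_add) measurable
  also have "\<dots> < \<infinity>"
    using n r_integrable[OF n(1)] r_nonneg[OF n(1)]
    by (simp add: nn_integral_eq_integral ennreal_add_less_top less_top[symmetric]) auto
  finally show ?thesis .
qed

lemma AE_N: "AE \<omega> in P. N \<omega> = ereal (R \<omega>)"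
proof -
  have "AE \<omega> in P. e2ennreal (N \<omega>) \<noteq> \<infinity>"
    using nn_integral_N_finite by (intro nn_integral_PInf_AE) auto
  then show ?thesis
  proof eventually_elim
    case (elim \<omega>)
    then show ?case using N_nonneg[of \<omega>] by (cases "N \<omega>") (auto simp: R_def)
  qed
qed

lemma nn_integral_N: "(\<integral>\<^sup>+\<omega>. e2ennreal (N \<omega>) \<partial>P) = (\<integral>\<^sup>+\<omega>. ennreal (R \<omega>) \<partial>P)"
proof (rule nn_integral_cong_AE)
  show "AE \<omega> in P. e2ennreal (N \<omega>) = ennreal (R \<omega>)"
    using AE_N by eventually_elim simp
qed

lemma R_integrable: "integrable P R"
proof (rule integrableI_nonneg)
  show "(\<integral>\<^sup>+\<omega>. ennreal (R \<omega>) \<partial>P) < \<infinity>"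
    using nn_integral_N_finite unfolding nn_integral_N .
qed (simp_all add: R_nonneg)

lemma r_tendsto: "AE \<omega> in P. (\<lambda>n. r n \<omega>) \<longlonglongrightarrow> R \<omega>"
  using conv AE_N by eventually_elim (simp add: r_def N_def)

text \<open>As \<open>N\<close> is almost surely the real number \<open>R\<close>, the extended
  expected distance is an ordinary integral for \<open>1 \<le> n\<close>, and convergence passes
  from extended to real numbers.\<close>

lemma r_tendsto_L1: "(\<lambda>n. \<integral>\<omega>. \<bar>r n \<omega> - R \<omega>\<bar> \<partial>P) \<longlonglongrightarrow> 0"
proof -
  have "(\<integral>\<^sup>+\<omega>. e2ennreal \<bar>ereal (r n \<omega>) - N \<omega>\<bar> \<partial>P) = ennreal (\<integral>\<omega>. \<bar>r n \<omega> - R \<omega>\<bar> \<partial>P)" if "1 \<le> n" for n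
  proof -
    have "(\<integral>\<^sup>+\<omega>. e2ennreal \<bar>ereal (r n \<omega>) - N \<omega>\<bar> \<partial>P) = (\<integral>\<^sup>+\<omega>. ennreal \<bar>r n \<omega> - R \<omega>\<bar> \<partial>P)"
    proof (rule nn_integral_cong_AE)
      show "AE \<omega> in P. e2ennreal \<bar>ereal (r n \<omega>) - N \<omega>\<bar> = ennreal \<bar>r n \<omega> - R \<omega>\<bar>"
        using AE_N by eventually_elim simp
    qed
    then show ?thesis
      using r_integrable[OF that] R_integrable by (simp add: nn_integral_eq_integral)
  qed
  then have "eventually (\<lambda>n. (\<integral>\<^sup>+\<omega>. e2ennreal \<bar>ereal (r n \<omega>) - N \<omega>\<bar> \<partial>P) = ennreal (\<integral>\<omega>. \<bar>r n \<omega> - R \<omega>\<bar> \<partial>P)) sequentially"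
    by (auto simp: eventually_sequentially)
  moreover have "(\<lambda>n. \<integral>\<^sup>+\<omega>. e2ennreal \<bar>ereal (r n \<omega>) - N \<omega>\<bar> \<partial>P) \<longlonglongrightarrow> 0"
    using L1 by (simp add: tendsto_L1_def r_def N_def)
  ultimately have "(\<lambda>n. ennreal (\<integral>\<omega>. \<bar>r n \<omega> - R \<omega>\<bar> \<partial>P)) \<longlonglongrightarrow> 0"
    by (rule Lim_transform_eventually[rotated])
  then show ?thesis by (simp add: ennreal_tendsto_0_iff)
qed

text \<open>\<open>min \<bar>\<xi> j\<bar> (K * r n)\<close> is even and homogeneous; \<open>n \<rightarrow> \<infinity>\<close> and then \<open>K \<rightarrow> \<infinity>\<close> show that \<open>E (\<bar>\<xi> j\<bar>; R \<noteq> 0)\<close> does not depend on \<open>j\<close>.\<close>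

lemma R_eq_0_imp_xi_eq_0: "AE \<omega> in P. R \<omega> = 0 \<longrightarrow> \<xi> j \<omega> = 0"
proof -
  have perm: "Transposition.transpose 0 j permutes {..<n}" if "j < n" for j n :: nat
    using that by (intro permutes_swap_id) auto
  have int_min: "(\<integral>\<omega>. min \<bar>\<xi> j \<omega>\<bar> (K * r n \<omega>) \<partial>P) = (\<integral>\<omega>. min \<bar>\<xi> 0 \<omega>\<bar> (K * r n \<omega>) \<partial>P)"
    if n: "j < n" and K: "0 \<le> K" for K j n
  proof -
    have n1: "1 \<le> n" using n by simp
    let ?f = "\<lambda>x. min \<bar>x 0\<bar> (K * partial_norm p n x)"
    have "(\<integral>\<omega>. ?f (\<lambda>i\<in>{..<n}. \<xi> (Transposition.transpose 0 j i) \<omega>) \<partial>P) = (\<integral>\<omega>. ?f (\<lambda>i\<in>{..<n}. \<xi> i \<omega>) \<partial>P)"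
    proof (rule swap_invariant_even_homogeneous[OF swap n1 perm[OF n]])
      have "(\<lambda>x. partial_norm p n (\<lambda>j. x j)) \<in> borel_measurable (Pi\<^sub>M {..<n} (\<lambda>_. borel))" by measurable
      moreover have [measurable]: "0 \<in> {..<n}" using n by simp
      ultimately show "?f \<in> borel_measurable (Pi\<^sub>M {..<n} (\<lambda>_. borel))" by measurable
    next
      fix x :: "nat \<Rightarrow> real" show "0 \<le> ?f x" using K n1 by (simp add: partial_norm_nonneg)
    next
      fix c and x :: "nat \<Rightarrow> real"
      have "partial_norm p n (\<lambda>j\<in>{..<n}. c * x j) = partial_norm p n (\<lambda>j. c * x j)"
        "partial_norm p n (\<lambda>j\<in>{..<n}. x j) = partial_norm p n x"
        by (rule partial_norm_cong, simp)+
      then show "?f (\<lambda>j\<in>{..<n}. c * x j) = \<bar>c\<bar> * ?f (\<lambda>j\<in>{..<n}. x j)"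
        using n1 by (simp add: partial_norm_cmult[OF p n1] abs_mult min_mult_distrib_left mult_ac)
    qed
    moreover have "partial_norm p n (\<lambda>i\<in>{..<n}. \<xi> (Transposition.transpose 0 j i) \<omega>) = r n \<omega>" for \<omega>
      using partial_norm_permute[OF perm[OF n], of p "\<lambda>i. \<xi> i \<omega>"] partial_norm_cong[of n "\<lambda>i\<in>{..<n}. \<xi> (Transposition.transpose 0 j i) \<omega>" "\<lambda>i. \<xi> (Transposition.transpose 0 j i) \<omega>" p]
      by (simp add: r_def)
    moreover have "partial_norm p n (\<lambda>i\<in>{..<n}. \<xi> i \<omega>) = r n \<omega>" for \<omega>
      unfolding r_def by (rule partial_norm_cong) simp
    ultimately show ?thesis using n1 by simp
  qed
  \<comment> \<open>Dominated by \<open>\<bar>\<xi> j\<bar>\<close>. The index is shifted by one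
    because \<open>r 0\<close> need not be non-negative.\<close>
  have lim_n: "(\<lambda>n. \<integral>\<omega>. min \<bar>\<xi> j \<omega>\<bar> (K * r n \<omega>) \<partial>P) \<longlonglongrightarrow> (\<integral>\<omega>. min \<bar>\<xi> j \<omega>\<bar> (K * R \<omega>) \<partial>P)" if K: "0 \<le> K" for K j
  proof (rule LIMSEQ_imp_Suc, rule integral_dominated_convergence[where w="\<lambda>\<omega>. \<bar>\<xi> j \<omega>\<bar>"])
    show "AE \<omega> in P. (\<lambda>n. min \<bar>\<xi> j \<omega>\<bar> (K * r (Suc n) \<omega>)) \<longlonglongrightarrow> min \<bar>\<xi> j \<omega>\<bar> (K * R \<omega>)"
      using r_tendsto
    proof eventually_elim
      case (elim \<omega>)
      then show ?case by (intro tendsto_intros LIMSEQ_Suc)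
    qed
    show "AE \<omega> in P. norm (min \<bar>\<xi> j \<omega>\<bar> (K * r (Suc n) \<omega>)) \<le> \<bar>\<xi> j \<omega>\<bar>" for n
      using K r_nonneg[of "Suc n"] by (auto simp: abs_of_nonneg)
  qed (auto simp: xi_integrable)
  have int_min_R: "(\<integral>\<omega>. min \<bar>\<xi> j \<omega>\<bar> (K * R \<omega>) \<partial>P) = (\<integral>\<omega>. min \<bar>\<xi> 0 \<omega>\<bar> (K * R \<omega>) \<partial>P)" if "0 \<le> K" for K j
  proof (rule LIMSEQ_unique[OF lim_n[OF that]])
    show "(\<lambda>n. \<integral>\<omega>. min \<bar>\<xi> j \<omega>\<bar> (K * r n \<omega>) \<partial>P) \<longlonglongrightarrow> (\<integral>\<omega>. min \<bar>\<xi> 0 \<omega>\<bar> (K * R \<omega>) \<partial>P)"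
    proof (rule Lim_transform_eventually[OF lim_n[OF that, of 0]])
      show "eventually (\<lambda>n. (\<integral>\<omega>. min \<bar>\<xi> 0 \<omega>\<bar> (K * r n \<omega>) \<partial>P) = (\<integral>\<omega>. min \<bar>\<xi> j \<omega>\<bar> (K * r n \<omega>) \<partial>P)) sequentially"
        using eventually_gt_at_top[of j] by eventually_elim (rule int_min[OF _ that, symmetric])
    qed
  qed
  have lim_K: "(\<lambda>m. \<integral>\<omega>. min \<bar>\<xi> j \<omega>\<bar> (real m * R \<omega>) \<partial>P) \<longlonglongrightarrow> (\<integral>\<omega>. \<bar>\<xi> j \<omega>\<bar> * indicator {x. R x \<noteq> 0} \<omega> \<partial>P)" for j
  proof (rule integral_dominated_convergence[where w="\<lambda>\<omega>. \<bar>\<xi> j \<omega>\<bar>"])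
    show "AE \<omega> in P. (\<lambda>m. min \<bar>\<xi> j \<omega>\<bar> (real m * R \<omega>)) \<longlonglongrightarrow> \<bar>\<xi> j \<omega>\<bar> * indicator {x. R x \<noteq> 0} \<omega>"
    proof (rule AE_I2)
      fix \<omega>
      show "(\<lambda>m. min \<bar>\<xi> j \<omega>\<bar> (real m * R \<omega>)) \<longlonglongrightarrow> \<bar>\<xi> j \<omega>\<bar> * indicator {x. R x \<noteq> 0} \<omega>"
      proof (cases "R \<omega> = 0")
        case False
        then have "R \<omega> > 0" using R_nonneg[of \<omega>] by simp
        obtain m0 where m0: "\<bar>\<xi> j \<omega>\<bar> / R \<omega> \<le> real m0" using real_arch_simple by blast
        have "min \<bar>\<xi> j \<omega>\<bar> (real m * R \<omega>) = \<bar>\<xi> j \<omega>\<bar>" if "m0 \<le> m" for m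
        proof -
          have "\<bar>\<xi> j \<omega>\<bar> / R \<omega> \<le> real m" using m0 that by linarith
          then show ?thesis using \<open>R \<omega> > 0\<close> by (simp add: divide_le_eq)
        qed
        then show ?thesis
          using False by (intro tendsto_eventually) (auto simp: eventually_sequentially)
      qed simp
    qed
  qed (use R_nonneg in \<open>auto simp: xi_integrable\<close>)
  have int_pos: "(\<integral>\<omega>. \<bar>\<xi> j \<omega>\<bar> * indicator {x. R x \<noteq> 0} \<omega> \<partial>P) = (\<integral>\<omega>. \<bar>\<xi> 0 \<omega>\<bar> * indicator {x. R x \<noteq> 0} \<omega> \<partial>P)" for j
    using lim_K[of j] lim_K[of 0] unfolding int_min_R[of "real _" j, OF of_nat_0_le_iff] by (rule LIMSEQ_unique)
  \<comment> \<open>Swap-invariance for the unit vector at 0 and the transposition of 0 and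
    \<open>j\<close>.\<close>
  have int_abs: "(\<integral>\<omega>. \<bar>\<xi> j \<omega>\<bar> \<partial>P) = (\<integral>\<omega>. \<bar>\<xi> 0 \<omega>\<bar> \<partial>P)" for j
  proof -
    have e: "(\<Sum>i<Suc j. (if i = 0 then 1 else 0) * y i) = y 0" for y :: "nat \<Rightarrow> real"
      by (simp add: if_distrib[of "\<lambda>a. a * _"] cong: if_cong)
    let ?u = "\<lambda>i. if i = 0 then 1 else 0 :: real"
    have "(\<integral>\<omega>. \<bar>\<Sum>i<Suc j. ?u i * \<xi> i \<omega>\<bar> \<partial>P) = (\<integral>\<omega>. \<bar>\<Sum>i<Suc j. ?u i * \<xi> (Transposition.transpose 0 j i) \<omega>\<bar> \<partial>P)"
      by (rule swap_invariantD[OF swap _ perm]) simp_all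
    then show ?thesis unfolding e by simp
  qed
  define c where "c j = (\<integral>\<omega>. \<bar>\<xi> j \<omega>\<bar> * indicator {x. R x = 0} \<omega> \<partial>P)" for j
  have int0: "integrable P (\<lambda>\<omega>. \<bar>\<xi> j \<omega>\<bar> * indicator {x. R x = 0} \<omega>)" for j
    by (rule Bochner_Integration.integrable_bound[OF xi_integrable[of j]]) (auto simp: indicator_def)
  have int1: "integrable P (\<lambda>\<omega>. \<bar>\<xi> j \<omega>\<bar> * indicator {x. R x \<noteq> 0} \<omega>)" for j
    by (rule Bochner_Integration.integrable_bound[OF xi_integrable[of j]]) (auto simp: indicator_def)
  have c: "c j = c 0" for j
  proof -
    have "(\<integral>\<omega>. \<bar>\<xi> i \<omega>\<bar> \<partial>P) = (\<integral>\<omega>. \<bar>\<xi> i \<omega>\<bar> * indicator {x. R x \<noteq> 0} \<omega> + \<bar>\<xi> i \<omega>\<bar> * indicator {x. R x = 0} \<omega> \<partial>P)" for i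
      by (intro Bochner_Integration.integral_cong) (auto simp: indicator_def)
    then have "(\<integral>\<omega>. \<bar>\<xi> i \<omega>\<bar> \<partial>P) = (\<integral>\<omega>. \<bar>\<xi> i \<omega>\<bar> * indicator {x. R x \<noteq> 0} \<omega> \<partial>P) + c i" for i
      unfolding c_def using int0 int1 by simp
    then show ?thesis using int_abs[of j] int_pos[of j] by simp
  qed
  \<comment> \<open>All \<open>c j\<close> are equal, so \<open>c 0\<close> is their average over
    \<open>j < n\<close>. Where \<open>R\<close> is 0 the average of
    \<open>\<bar>\<xi> j\<bar>\<close> is at most \<open>r n\<close>, which there coincides with
    \<open>\<bar>r n - R\<bar>\<close>; the expectation of the latter tends to 0.\<close>
  have "c 0 \<le> (\<integral>\<omega>. \<bar>r n \<omega> - R \<omega>\<bar> \<partial>P)" if n: "1 \<le> n" for n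
  proof -
    have "real n * c 0 = (\<Sum>j<n. c j)"
      using sum.cong[of "{..<n}" "{..<n}" c "\<lambda>_. c 0", OF refl c] by simp
    also have "\<dots> = (\<integral>\<omega>. (\<Sum>j<n. \<bar>\<xi> j \<omega>\<bar> * indicator {x. R x = 0} \<omega>) \<partial>P)"
      unfolding c_def by (rule Bochner_Integration.integral_sum[symmetric]) (rule int0)
    also have "\<dots> \<le> (\<integral>\<omega>. real n * \<bar>r n \<omega> - R \<omega>\<bar> \<partial>P)"
    proof (rule integral_mono)
      fix \<omega>
      show "(\<Sum>j<n. \<bar>\<xi> j \<omega>\<bar> * indicator {x. R x = 0} \<omega>) \<le> real n * \<bar>r n \<omega> - R \<omega>\<bar>"
      proof (cases "R \<omega> = 0")
        case True
        have "(\<Sum>j<n. \<bar>\<xi> j \<omega>\<bar>) \<le> real n * r n \<omega>"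
          using mean_abs_le_partial_norm[OF p n, of "\<lambda>j. \<xi> j \<omega>"] n by (simp add: r_def divide_le_eq mult.commute)
        then show ?thesis using True r_nonneg[OF n] by (simp add: abs_of_nonneg)
      qed simp
    next
      show "integrable P (\<lambda>\<omega>. \<Sum>j<n. \<bar>\<xi> j \<omega>\<bar> * indicator {x. R x = 0} \<omega>)"
        by (rule Bochner_Integration.integrable_sum) (rule int0)
      show "integrable P (\<lambda>\<omega>. real n * \<bar>r n \<omega> - R \<omega>\<bar>)"
        using r_integrable[OF n] R_integrable by simp
    qed
    finally show ?thesis using n by simp
  qed
  then have "c 0 \<le> 0"
    by (intro LIMSEQ_le_const[OF r_tendsto_L1]) auto
  then have "c j \<le> 0" using c[of j] by simp
  moreover have "0 \<le> c j" unfolding c_def by (intro Bochner_Integration.integral_nonneg) auto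
  ultimately have "c j = 0" by simp
  then have "AE \<omega> in P. \<bar>\<xi> j \<omega>\<bar> * indicator {x. R x = 0} \<omega> = 0"
    unfolding c_def by (subst (asm) integral_nonneg_eq_0_iff_AE[OF int0]) auto
  then show ?thesis by eventually_elim auto
qed

section \<open>Permutation invariance of normalised integrals\<close>

text \<open>With \<open>g a\<close> the test function normalised by \<open>a\<close>, the difference
  of the integrands splits as \<open>(r n - R) * g (r n) + R * (g (r n) - g R)\<close>. The first
  term is controlled by convergence in mean of \<open>r n\<close>, the second by dominated
  convergence with bound \<open>2 * R\<close>.\<close>

lemma tendsto_normalised_integral:
  fixes G \<phi> :: "real \<Rightarrow> real"
  assumes G: "continuous_on UNIV G" "\<And>x. \<bar>G x\<bar> \<le> 1" and \<phi>: "continuous_on UNIV \<phi>"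
  shows "(\<lambda>n. \<integral>\<omega>. r n \<omega> * G (\<Sum>j<k. u j * \<phi> (\<xi> (\<sigma> j) \<omega> / r n \<omega>)) \<partial>P) \<longlonglongrightarrow>
    (\<integral>\<omega>. R \<omega> * G (\<Sum>j<k. u j * \<phi> (\<xi> (\<sigma> j) \<omega> / R \<omega>)) \<partial>P)"
proof -
  have [measurable]: "G \<in> borel_measurable borel" "\<phi> \<in> borel_measurable borel"
    using G \<phi> by (auto intro: borel_measurable_continuous_onI)
  define g where "g a \<omega> = G (\<Sum>j<k. u j * \<phi> (\<xi> (\<sigma> j) \<omega> / a))" for a \<omega>
  have g1: "\<bar>g a \<omega>\<bar> \<le> 1" for a \<omega> unfolding g_def by (rule G)
  have [measurable]: "(\<lambda>\<omega>. g (r n \<omega>) \<omega>) \<in> borel_measurable P" "(\<lambda>\<omega>. g (R \<omega>) \<omega>) \<in> borel_measurable P" for n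
    unfolding g_def by measurable
  have lim: "(\<lambda>n. \<integral>\<omega>. R \<omega> * \<bar>g (r n \<omega>) \<omega> - g (R \<omega>) \<omega>\<bar> \<partial>P) \<longlonglongrightarrow> (\<integral>\<omega>. 0 \<partial>P)"
  proof (rule integral_dominated_convergence[where w="\<lambda>\<omega>. 2 * R \<omega>"])
    show "AE \<omega> in P. (\<lambda>n. R \<omega> * \<bar>g (r n \<omega>) \<omega> - g (R \<omega>) \<omega>\<bar>) \<longlonglongrightarrow> 0"
      using r_tendsto
    proof eventually_elim
      case (elim \<omega>)
      show ?case
      \<comment> \<open>The quotients converge only where \<open>R\<close> is non-zero; elsewhere
        the factor \<open>R\<close> annihilates the term.\<close>
      proof (cases "R \<omega> = 0")
        case False
        have "isCont \<phi> x" "isCont G x" for x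
          using \<phi> G by (auto simp: continuous_on_eq_continuous_at)
        then have "(\<lambda>n. g (r n \<omega>) \<omega>) \<longlonglongrightarrow> g (R \<omega>) \<omega>"
          unfolding g_def using elim False
          by (intro isCont_tendsto_compose[of _ G] tendsto_sum tendsto_mult tendsto_const
              isCont_tendsto_compose[of _ \<phi>] tendsto_divide)
        then have "(\<lambda>n. R \<omega> * \<bar>g (r n \<omega>) \<omega> - g (R \<omega>) \<omega>\<bar>) \<longlonglongrightarrow> R \<omega> * \<bar>g (R \<omega>) \<omega> - g (R \<omega>) \<omega>\<bar>"
          by (intro tendsto_intros)
        then show ?thesis by simp
      qed simp
    qed
    show "AE \<omega> in P. norm (R \<omega> * \<bar>g (r n \<omega>) \<omega> - g (R \<omega>) \<omega>\<bar>) \<le> 2 * R \<omega>" for n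
    proof (rule AE_I2)
      fix \<omega>
      have "\<bar>g (r n \<omega>) \<omega> - g (R \<omega>) \<omega>\<bar> \<le> 2"
        using g1[of "r n \<omega>" \<omega>] g1[of "R \<omega>" \<omega>] by linarith
      then have "R \<omega> * \<bar>g (r n \<omega>) \<omega> - g (R \<omega>) \<omega>\<bar> \<le> R \<omega> * 2"
        by (intro mult_left_mono R_nonneg)
      then show "norm (R \<omega> * \<bar>g (r n \<omega>) \<omega> - g (R \<omega>) \<omega>\<bar>) \<le> 2 * R \<omega>"
        using R_nonneg[of \<omega>] by (simp add: abs_mult mult.commute)
    qed
  qed (use R_integrable in auto)
  have intg: "integrable P (\<lambda>\<omega>. f \<omega> * g (h \<omega>) \<omega>)"
    if "integrable P f" "(\<lambda>\<omega>. g (h \<omega>) \<omega>) \<in> borel_measurable P" for f h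
  proof (rule Bochner_Integration.integrable_bound[OF that(1)])
    show "AE \<omega> in P. norm (f \<omega> * g (h \<omega>) \<omega>) \<le> norm (f \<omega>)"
      using g1 by (auto simp: abs_mult intro!: mult_left_le)
  qed (use that in measurable)
  have "(\<lambda>n. (\<integral>\<omega>. r n \<omega> * g (r n \<omega>) \<omega> \<partial>P) - (\<integral>\<omega>. R \<omega> * g (R \<omega>) \<omega> \<partial>P)) \<longlonglongrightarrow> 0"
  proof (rule Lim_null_comparison)
    show "(\<lambda>n. (\<integral>\<omega>. \<bar>r n \<omega> - R \<omega>\<bar> \<partial>P) + (\<integral>\<omega>. R \<omega> * \<bar>g (r n \<omega>) \<omega> - g (R \<omega>) \<omega>\<bar> \<partial>P)) \<longlonglongrightarrow> 0"
      using tendsto_add[OF r_tendsto_L1 lim] by simp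
    show "eventually (\<lambda>n. norm ((\<integral>\<omega>. r n \<omega> * g (r n \<omega>) \<omega> \<partial>P) - (\<integral>\<omega>. R \<omega> * g (R \<omega>) \<omega> \<partial>P)) \<le>
       (\<integral>\<omega>. \<bar>r n \<omega> - R \<omega>\<bar> \<partial>P) + (\<integral>\<omega>. R \<omega> * \<bar>g (r n \<omega>) \<omega> - g (R \<omega>) \<omega>\<bar> \<partial>P)) sequentially"
      using eventually_ge_at_top[of 1]
    proof eventually_elim
      case (elim n)
      have i1: "integrable P (\<lambda>\<omega>. r n \<omega> * g (r n \<omega>) \<omega>)" and i2: "integrable P (\<lambda>\<omega>. R \<omega> * g (R \<omega>) \<omega>)"
        and i3: "integrable P (\<lambda>\<omega>. R \<omega> * g (r n \<omega>) \<omega>)"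
        by (intro intg r_integrable[OF elim] R_integrable; measurable)+
      have i4: "integrable P (\<lambda>\<omega>. \<bar>r n \<omega> - R \<omega>\<bar>)" using r_integrable[OF elim] R_integrable by simp
      have "integrable P (\<lambda>\<omega>. \<bar>R \<omega> * g (r n \<omega>) \<omega> - R \<omega> * g (R \<omega>) \<omega>\<bar>)" using i2 i3 by simp
      then have i5: "integrable P (\<lambda>\<omega>. R \<omega> * \<bar>g (r n \<omega>) \<omega> - g (R \<omega>) \<omega>\<bar>)"
        using R_nonneg by (simp add: abs_mult flip: right_diff_distrib)
      have "norm ((\<integral>\<omega>. r n \<omega> * g (r n \<omega>) \<omega> \<partial>P) - (\<integral>\<omega>. R \<omega> * g (R \<omega>) \<omega> \<partial>P)) =
        norm (\<integral>\<omega>. r n \<omega> * g (r n \<omega>) \<omega> - R \<omega> * g (R \<omega>) \<omega> \<partial>P)"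
        using i1 i2 by simp
      also have "\<dots> \<le> (\<integral>\<omega>. norm (r n \<omega> * g (r n \<omega>) \<omega> - R \<omega> * g (R \<omega>) \<omega>) \<partial>P)"
        by (rule integral_norm_bound)
      also have "\<dots> \<le> (\<integral>\<omega>. \<bar>r n \<omega> - R \<omega>\<bar> + R \<omega> * \<bar>g (r n \<omega>) \<omega> - g (R \<omega>) \<omega>\<bar> \<partial>P)"
      proof (rule integral_mono)
        fix \<omega>
        have "r n \<omega> * g (r n \<omega>) \<omega> - R \<omega> * g (R \<omega>) \<omega> = (r n \<omega> - R \<omega>) * g (r n \<omega>) \<omega> + R \<omega> * (g (r n \<omega>) \<omega> - g (R \<omega>) \<omega>)"
          by (simp add: algebra_simps)
        also have "norm \<dots> \<le> \<bar>(r n \<omega> - R \<omega>) * g (r n \<omega>) \<omega>\<bar> + \<bar>R \<omega> * (g (r n \<omega>) \<omega> - g (R \<omega>) \<omega>)\<bar>"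
          unfolding real_norm_def by (rule abs_triangle_ineq)
        also have "\<dots> \<le> \<bar>r n \<omega> - R \<omega>\<bar> + R \<omega> * \<bar>g (r n \<omega>) \<omega> - g (R \<omega>) \<omega>\<bar>"
          using g1 R_nonneg by (intro add_mono) (auto simp: abs_mult intro!: mult_left_le)
        finally show "norm (r n \<omega> * g (r n \<omega>) \<omega> - R \<omega> * g (R \<omega>) \<omega>) \<le> \<bar>r n \<omega> - R \<omega>\<bar> + R \<omega> * \<bar>g (r n \<omega>) \<omega> - g (R \<omega>) \<omega>\<bar>" .
      qed (use i1 i2 i4 i5 in auto)
      also have "\<dots> = (\<integral>\<omega>. \<bar>r n \<omega> - R \<omega>\<bar> \<partial>P) + (\<integral>\<omega>. R \<omega> * \<bar>g (r n \<omega>) \<omega> - g (R \<omega>) \<omega>\<bar> \<partial>P)"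
        using i4 i5 by simp
      finally show ?case .
    qed
  qed
  then show ?thesis unfolding g_def by (rule LIM_zero_cancel)
qed

text \<open>With \<open>r n\<close> in place of \<open>R\<close> and \<open>n\<close> at least
  \<open>k\<close>, the integrand plus \<open>r n\<close> is a non-negative even homogeneous
  function of the first \<open>n\<close> variables, and \<open>r n\<close> is itself unchanged by
  the permutation. Swap-invariance then gives equality for each such \<open>n\<close>, and the limit
  is taken. Evenness is required of the composite only: it holds for \<open>G = cos\<close> with
  \<open>\<phi>\<close> the identity, and for any \<open>G\<close> with
  \<open>\<phi> = abs\<close>.\<close>

lemma normalised_integral_permute:
  fixes G \<phi> :: "real \<Rightarrow> real"
  assumes G: "continuous_on UNIV G" "\<And>x. \<bar>G x\<bar> \<le> 1" and \<phi>: "continuous_on UNIV \<phi>"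
    and even: "\<And>y. G (\<Sum>j<k. u j * \<phi> (- y j)) = G (\<Sum>j<k. u j * \<phi> (y j))"
    and \<pi>: "\<pi> permutes {..<k}"
  shows "(\<integral>\<omega>. R \<omega> * G (\<Sum>j<k. u j * \<phi> (\<xi> (\<pi> j) \<omega> / R \<omega>)) \<partial>P) =
    (\<integral>\<omega>. R \<omega> * G (\<Sum>j<k. u j * \<phi> (\<xi> j \<omega> / R \<omega>)) \<partial>P)"
proof -
  have [measurable]: "G \<in> borel_measurable borel" "\<phi> \<in> borel_measurable borel"
    using G \<phi> by (auto intro: borel_measurable_continuous_onI)
  have eq: "(\<integral>\<omega>. r n \<omega> * G (\<Sum>j<k. u j * \<phi> (\<xi> (\<pi> j) \<omega> / r n \<omega>)) \<partial>P) =
      (\<integral>\<omega>. r n \<omega> * G (\<Sum>j<k. u j * \<phi> (\<xi> j \<omega> / r n \<omega>)) \<partial>P)" if n: "1 \<le> n" and k: "k \<le> n" for n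
  proof -
    \<comment> \<open>The norm \<open>r n\<close> involves more variables than the test function, so
      \<open>\<pi>\<close> is viewed as a permutation of the larger index set that fixes the
      rest.\<close>
    have \<pi>n: "\<pi> permutes {..<n}" by (rule permutes_subset[OF \<pi>]) (use k in auto)
    \<comment> \<open>\<open>1 + G\<close> instead of \<open>G\<close>, because the integrand must be non-negative.\<close>
    let ?f = "\<lambda>x. partial_norm p n x * (1 + G (\<Sum>j<k. u j * \<phi> (x j / partial_norm p n x)))"
    have f_cong: "?f x = ?f y" if "\<And>j. j < n \<Longrightarrow> x j = y j" for x y
    proof -
      have "partial_norm p n x = partial_norm p n y" using that by (rule partial_norm_cong)
      moreover have "x j = y j" if "j < k" for j using that k \<open>\<And>j. j < n \<Longrightarrow> x j = y j\<close> by simp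
      ultimately show ?thesis by simp
    qed
    have G0: "0 \<le> 1 + G x" for x using G(2)[of x] by linarith
    have swap': "(\<integral>\<omega>. ?f (\<lambda>j\<in>{..<n}. \<xi> (\<pi> j) \<omega>) \<partial>P) = (\<integral>\<omega>. ?f (\<lambda>j\<in>{..<n}. \<xi> j \<omega>) \<partial>P)"
    proof (rule swap_invariant_even_homogeneous[OF swap n \<pi>n])
      have [measurable]: "(\<lambda>x. partial_norm p n x) \<in> borel_measurable (Pi\<^sub>M {..<n} (\<lambda>_. borel))"
        by (rule borel_measurable_partial_norm) auto
      have "(\<lambda>x. \<Sum>j<k. u j * \<phi> (x j / partial_norm p n x)) \<in> borel_measurable (Pi\<^sub>M {..<n} (\<lambda>_. borel))"
      proof (intro borel_measurable_sum borel_measurable_times borel_measurable_const)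
        fix j assume "j \<in> {..<k}"
        then have [measurable]: "j \<in> {..<n}" using k by auto
        show "(\<lambda>x. \<phi> (x j / partial_norm p n x)) \<in> borel_measurable (Pi\<^sub>M {..<n} (\<lambda>_. borel))" by measurable
      qed
      then show "?f \<in> borel_measurable (Pi\<^sub>M {..<n} (\<lambda>_. borel))" by measurable
    next
      fix x :: "nat \<Rightarrow> real"
      show "0 \<le> ?f x" using G0 n by (intro mult_nonneg_nonneg partial_norm_nonneg)
    next
      fix c and x :: "nat \<Rightarrow> real"
      have "?f (\<lambda>j\<in>{..<n}. c * x j) = ?f (\<lambda>j. c * x j)" by (rule f_cong) simp
      also have "\<dots> = \<bar>c\<bar> * ?f x"
      proof -
        \<comment> \<open>A positive \<open>c\<close> cancels in the quotients, a negative one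
          changes their sign, which \<open>even\<close> absorbs; for \<open>c = 0\<close> the
          partial norm in front vanishes.\<close>
        consider "c = 0" | "c > 0" | "c < 0" by linarith
        then show ?thesis
        proof cases
          case 1
          then show ?thesis using partial_norm_cmult[OF p n, of 0 "\<lambda>_. 0"] by simp
        next
          case 3
          then have "c * x j / (- (c * partial_norm p n x)) = - (x j / partial_norm p n x)" for j
            by (simp add: field_simps)
          then show ?thesis
            using 3 even[of "\<lambda>j. x j / partial_norm p n x"] by (simp add: partial_norm_cmult[OF p n])
        qed (simp_all add: partial_norm_cmult[OF p n])
      qed
      also have "?f x = ?f (\<lambda>j\<in>{..<n}. x j)" by (rule f_cong) simp
      finally show "?f (\<lambda>j\<in>{..<n}. c * x j) = \<bar>c\<bar> * ?f (\<lambda>j\<in>{..<n}. x j)" .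
    qed
    have f_r: "?f (\<lambda>j\<in>{..<n}. \<xi> (\<sigma> j) \<omega>) = r n \<omega> * (1 + G (\<Sum>j<k. u j * \<phi> (\<xi> (\<sigma> j) \<omega> / r n \<omega>)))"
      if "\<sigma> permutes {..<n}" for \<sigma> \<omega>
    proof -
      have "?f (\<lambda>j\<in>{..<n}. \<xi> (\<sigma> j) \<omega>) = ?f (\<lambda>j. \<xi> (\<sigma> j) \<omega>)" by (rule f_cong) simp
      then show ?thesis
        using partial_norm_permute[OF that, of p "\<lambda>j. \<xi> j \<omega>"] by (simp add: r_def)
    qed
    have int: "(\<integral>\<omega>. r n \<omega> * (1 + G (\<Sum>j<k. u j * \<phi> (\<xi> (\<sigma> j) \<omega> / r n \<omega>))) \<partial>P) =
      (\<integral>\<omega>. r n \<omega> \<partial>P) + (\<integral>\<omega>. r n \<omega> * G (\<Sum>j<k. u j * \<phi> (\<xi> (\<sigma> j) \<omega> / r n \<omega>)) \<partial>P)" for \<sigma>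
    proof -
      have "integrable P (\<lambda>\<omega>. r n \<omega> * G (\<Sum>j<k. u j * \<phi> (\<xi> (\<sigma> j) \<omega> / r n \<omega>)))"
      proof (rule Bochner_Integration.integrable_bound[OF r_integrable[OF n]])
        show "AE \<omega> in P. norm (r n \<omega> * G (\<Sum>j<k. u j * \<phi> (\<xi> (\<sigma> j) \<omega> / r n \<omega>))) \<le> norm (r n \<omega>)"
          using G(2) by (auto simp: abs_mult intro!: mult_left_le)
      qed measurable
      then show ?thesis
        using r_integrable[OF n] by (simp add: distrib_left)
    qed
    show ?thesis
      using swap' unfolding f_r[OF \<pi>n] f_r[OF permutes_id, unfolded id_apply] int by simp
  qed
  show ?thesis
  proof (rule LIMSEQ_unique)
    show "(\<lambda>n. \<integral>\<omega>. r n \<omega> * G (\<Sum>j<k. u j * \<phi> (\<xi> (\<pi> j) \<omega> / r n \<omega>)) \<partial>P) \<longlonglongrightarrow>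
      (\<integral>\<omega>. R \<omega> * G (\<Sum>j<k. u j * \<phi> (\<xi> (\<pi> j) \<omega> / R \<omega>)) \<partial>P)"
      by (rule tendsto_normalised_integral[OF G \<phi>])
    show "(\<lambda>n. \<integral>\<omega>. r n \<omega> * G (\<Sum>j<k. u j * \<phi> (\<xi> (\<pi> j) \<omega> / r n \<omega>)) \<partial>P) \<longlonglongrightarrow>
      (\<integral>\<omega>. R \<omega> * G (\<Sum>j<k. u j * \<phi> (\<xi> j \<omega> / R \<omega>)) \<partial>P)"
    proof (rule Lim_transform_eventually[OF tendsto_normalised_integral[OF G \<phi>]])
      show "eventually (\<lambda>n. (\<integral>\<omega>. r n \<omega> * G (\<Sum>j<k. u j * \<phi> (\<xi> j \<omega> / r n \<omega>)) \<partial>P) =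
        (\<integral>\<omega>. r n \<omega> * G (\<Sum>j<k. u j * \<phi> (\<xi> (\<pi> j) \<omega> / r n \<omega>)) \<partial>P)) sequentially"
        using eventually_ge_at_top[of 1] eventually_ge_at_top[of k]
        by eventually_elim (rule eq[symmetric])
    qed
  qed
qed

section \<open>Reduction of exchangeability to weighted trigonometric integrals\<close>

text \<open>Up to a null set the density is \<open>R / c\<close> with \<open>c\<close> the
  expectation of \<open>R\<close>, so integrals under the new measure are integrals under
  \<open>P\<close> weighted by \<open>R\<close> and divided by the constant
  \<open>c\<close>.\<close>

lemma exchangeable_densityI:
  assumes pos: "0 < (\<integral>\<^sup>+\<omega>. e2ennreal (N \<omega>) \<partial>P)"
    and \<zeta>[measurable]: "\<And>j. \<zeta> j \<in> borel_measurable P"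
    and trig: "\<And>k \<pi> \<theta> u. \<pi> permutes {..<k} \<Longrightarrow>
      (\<integral>\<omega>. R \<omega> * cos (\<theta> + (\<Sum>j<k. u j * \<zeta> (\<pi> j) \<omega>)) \<partial>P) = (\<integral>\<omega>. R \<omega> * cos (\<theta> + (\<Sum>j<k. u j * \<zeta> j \<omega>)) \<partial>P)"
  shows "exchangeable (density P (\<lambda>\<omega>. e2ennreal (N \<omega>) / (\<integral>\<^sup>+\<omega>. e2ennreal (N \<omega>) \<partial>P))) \<zeta>"
proof -
  define c where "c = (\<integral>\<omega>. R \<omega> \<partial>P)"
  have c: "(\<integral>\<^sup>+\<omega>. e2ennreal (N \<omega>) \<partial>P) = ennreal c"
    unfolding nn_integral_N c_def using R_integrable R_nonneg by (simp add: nn_integral_eq_integral)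
  have c0: "0 < c" using pos unfolding c by simp
  have Q: "density P (\<lambda>\<omega>. e2ennreal (N \<omega>) / (\<integral>\<^sup>+\<omega>. e2ennreal (N \<omega>) \<partial>P)) = density P (\<lambda>\<omega>. ennreal (R \<omega> / c))"
  proof (rule density_cong)
    show "AE \<omega> in P. e2ennreal (N \<omega>) / (\<integral>\<^sup>+\<omega>. e2ennreal (N \<omega>) \<partial>P) = ennreal (R \<omega> / c)"
      unfolding c using AE_N by eventually_elim (simp add: divide_ennreal R_nonneg c0)
  qed measurable
  have int: "(\<integral>\<omega>. f \<omega> \<partial>density P (\<lambda>\<omega>. ennreal (R \<omega> / c))) = (\<integral>\<omega>. R \<omega> * f \<omega> \<partial>P) / c"
    if [measurable]: "f \<in> borel_measurable P" for f :: "'a \<Rightarrow> real"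
    using c0 R_nonneg by (subst integral_density) auto
  show ?thesis
    unfolding Q
  proof (rule exchangeableI_trig)
    have "emeasure (density P (\<lambda>\<omega>. ennreal (R \<omega> / c))) (space P) = (\<integral>\<^sup>+\<omega>. ennreal (R \<omega> / c) \<partial>P)"
      by (subst emeasure_density) (auto intro!: nn_integral_cong)
    also have "\<dots> < \<infinity>"
      using R_integrable R_nonneg c0 by (subst nn_integral_eq_integral) auto
    finally show "finite_measure (density P (\<lambda>\<omega>. ennreal (R \<omega> / c)))"
      by (intro finite_measureI) simp
    show "\<zeta> j \<in> borel_measurable (density P (\<lambda>\<omega>. ennreal (R \<omega> / c)))" for j by simp
    show "(\<integral>\<omega>. cos (\<theta> + (\<Sum>j<k. u j * \<zeta> (\<pi> j) \<omega>)) \<partial>density P (\<lambda>\<omega>. ennreal (R \<omega> / c))) =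
      (\<integral>\<omega>. cos (\<theta> + (\<Sum>j<k. u j * \<zeta> j \<omega>)) \<partial>density P (\<lambda>\<omega>. ennreal (R \<omega> / c)))"
      if "\<pi> permutes {..<k}" for k \<pi> \<theta> u
      using trig[OF that] by (simp add: int)
  qed
qed

lemma R_mult_bounded_integrable:
  assumes [measurable]: "g \<in> borel_measurable P" and "\<And>\<omega>. \<bar>g \<omega>\<bar> \<le> 1"
  shows "integrable P (\<lambda>\<omega>. R \<omega> * g \<omega>)"
proof (rule Bochner_Integration.integrable_bound[OF R_integrable])
  show "AE \<omega> in P. norm (R \<omega> * g \<omega>) \<le> norm (R \<omega>)"
    using assms(2) by (auto simp: abs_mult intro!: mult_left_le)
qed measurable

text \<open>The addition formula splits \<open>cos (\<theta> + S)\<close> into a cosine and a sine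
  part. The sine part integrates to 0; the cosine part is an even test function of
  \<open>\<xi> / R\<close>, to which \<open>normalised_integral_permute\<close> applies. This covers
  both a random sign and a symmetric sequence.\<close>

lemma exchangeable_densityI_symmetric:
  assumes pos: "0 < (\<integral>\<^sup>+\<omega>. e2ennreal (N \<omega>) \<partial>P)"
    and \<zeta>[measurable]: "\<And>j. \<zeta> j \<in> borel_measurable P"
    and cos: "\<And>(k :: nat) \<sigma> u. AE \<omega> in P. cos (\<Sum>j<k. u j * \<zeta> (\<sigma> j) \<omega>) = cos (\<Sum>j<k. u j * (\<xi> (\<sigma> j) \<omega> / R \<omega>))"
    and sin: "\<And>(k :: nat) \<sigma> u. (\<integral>\<omega>. R \<omega> * sin (\<Sum>j<k. u j * \<zeta> (\<sigma> j) \<omega>) \<partial>P) = 0"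
  shows "exchangeable (density P (\<lambda>\<omega>. e2ennreal (N \<omega>) / (\<integral>\<^sup>+\<omega>. e2ennreal (N \<omega>) \<partial>P))) \<zeta>"
proof (rule exchangeable_densityI[OF pos \<zeta>])
  fix k :: nat and \<pi> \<theta> and u :: "nat \<Rightarrow> real" assume \<pi>: "\<pi> permutes {..<k}"
  have *: "(\<integral>\<omega>. R \<omega> * cos (\<theta> + (\<Sum>j<k. u j * \<zeta> (\<sigma> j) \<omega>)) \<partial>P) =
      cos \<theta> * (\<integral>\<omega>. R \<omega> * cos (\<Sum>j<k. u j * (\<xi> (\<sigma> j) \<omega> / R \<omega>)) \<partial>P)" for \<sigma>
  proof -
    let ?S = "\<lambda>\<omega>. \<Sum>j<k. u j * \<zeta> (\<sigma> j) \<omega>"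
    have [measurable]: "?S \<in> borel_measurable P" by measurable
    have i: "integrable P (\<lambda>\<omega>. R \<omega> * cos (?S \<omega>))" "integrable P (\<lambda>\<omega>. R \<omega> * sin (?S \<omega>))"
      by (rule R_mult_bounded_integrable; simp)+
    have "(\<integral>\<omega>. R \<omega> * cos (\<theta> + ?S \<omega>) \<partial>P) = (\<integral>\<omega>. cos \<theta> * (R \<omega> * cos (?S \<omega>)) - sin \<theta> * (R \<omega> * sin (?S \<omega>)) \<partial>P)"
      by (simp add: cos_add algebra_simps)
    also have "\<dots> = cos \<theta> * (\<integral>\<omega>. R \<omega> * cos (?S \<omega>) \<partial>P) - sin \<theta> * (\<integral>\<omega>. R \<omega> * sin (?S \<omega>) \<partial>P)"
      using i by simp
    also have "(\<integral>\<omega>. R \<omega> * sin (?S \<omega>) \<partial>P) = 0" by (rule sin)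
    also have "(\<integral>\<omega>. R \<omega> * cos (?S \<omega>) \<partial>P) = (\<integral>\<omega>. R \<omega> * cos (\<Sum>j<k. u j * (\<xi> (\<sigma> j) \<omega> / R \<omega>)) \<partial>P)"
    proof (rule integral_cong_AE)
      show "AE \<omega> in P. R \<omega> * cos (?S \<omega>) = R \<omega> * cos (\<Sum>j<k. u j * (\<xi> (\<sigma> j) \<omega> / R \<omega>))"
        using cos[of u \<sigma> k] by eventually_elim simp
    qed measurable
    finally show ?thesis by simp
  qed
  have "(\<integral>\<omega>. R \<omega> * cos (\<Sum>j<k. u j * (\<lambda>y. y) (\<xi> (\<pi> j) \<omega> / R \<omega>)) \<partial>P) =
    (\<integral>\<omega>. R \<omega> * cos (\<Sum>j<k. u j * (\<lambda>y. y) (\<xi> j \<omega> / R \<omega>)) \<partial>P)"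
    by (rule normalised_integral_permute[OF _ _ _ _ \<pi>]) (auto intro!: continuous_intros simp: sum_negf)
  then show "(\<integral>\<omega>. R \<omega> * cos (\<theta> + (\<Sum>j<k. u j * \<zeta> (\<pi> j) \<omega>)) \<partial>P) = (\<integral>\<omega>. R \<omega> * cos (\<theta> + (\<Sum>j<k. u j * \<zeta> j \<omega>)) \<partial>P)"
    using *[of \<pi>] *[of "\<lambda>j. j"] by simp
qed

section \<open>Random signs, symmetric and non-negative sequences\<close>

text \<open>The sine integrand as an odd measurable function on sequence space, so that independence
  of the sign from the whole sequence, or equality of the laws of \<open>\<xi>\<close> and its
  negative, can be applied to it.\<close>

definition sin_functional :: "nat \<Rightarrow> (nat \<Rightarrow> nat) \<Rightarrow> (nat \<Rightarrow> real) \<Rightarrow> (nat \<Rightarrow> real) \<Rightarrow> real" where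
  "sin_functional k \<sigma> u x = real_of_ereal (limsup_norm p x) *
     sin (\<Sum>j<k. u j * (x (\<sigma> j) / real_of_ereal (limsup_norm p x)))"

lemma sin_functional_xi:
  "sin_functional k \<sigma> u (\<lambda>j. \<xi> j \<omega>) = R \<omega> * sin (\<Sum>j<k. u j * (\<xi> (\<sigma> j) \<omega> / R \<omega>))"
  by (simp add: sin_functional_def R_def N_def)

lemma sin_functional_measurable[measurable]:
  "sin_functional k \<sigma> u \<in> borel_measurable (Pi\<^sub>M UNIV (\<lambda>_. borel))"
proof -
  have [measurable]: "(\<lambda>x. limsup_norm p x) \<in> borel_measurable (Pi\<^sub>M UNIV (\<lambda>_. borel))"
    unfolding limsup_norm_def
    by (intro borel_measurable_limsup borel_measurable_ereal borel_measurable_partial_norm) auto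
  show ?thesis unfolding sin_functional_def[abs_def] by measurable
qed

lemma sin_functional_uminus: "sin_functional k \<sigma> u (\<lambda>j. - x j) = - sin_functional k \<sigma> u x"
proof -
  have "partial_norm p n (\<lambda>j. - x j) = partial_norm p n x" for n
    by (cases "p = \<infinity>") (simp_all add: partial_norm_def)
  then have "limsup_norm p (\<lambda>j. - x j) = limsup_norm p x"
    by (simp add: limsup_norm_def)
  then show ?thesis by (simp add: sin_functional_def sum_negf)
qed

text \<open>Where \<open>R\<close> is non-zero it cancels; where it is 0, \<open>\<xi> j\<close>
  vanishes almost surely as well, so both sides are 0. The factor \<open>s\<close> is the random
  sign or the constant 1.\<close>

lemma xi_eq_normalised:
  assumes "AE \<omega> in P. X \<omega> = s \<omega> * \<xi> j \<omega>"
  shows "AE \<omega> in P. ereal (X \<omega>) = N \<omega> * ereal (s \<omega> * \<xi> j \<omega> / R \<omega>)"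
  using assms AE_N R_eq_0_imp_xi_eq_0[of j] by eventually_elim auto

text \<open>The cosine is even, so the sign drops out of it. The sine is odd, so the sign comes out
  as a factor that is independent of the rest and has mean 0.\<close>

lemma exchangeable_random_sign:
  assumes pos: "0 < (\<integral>\<^sup>+\<omega>. e2ennreal (N \<omega>) \<partial>P)"
    and ind: "indep_random_variables P borel \<epsilon> (Pi\<^sub>M UNIV (\<lambda>_. borel)) (\<lambda>\<omega> j. \<xi> j \<omega>)"
    and half: "prob {\<omega> \<in> space P. \<epsilon> \<omega> = 1} = 1 / 2" "prob {\<omega> \<in> space P. \<epsilon> \<omega> = -1} = 1 / 2"
  shows "exchangeable (density P (\<lambda>\<omega>. e2ennreal (N \<omega>) / (\<integral>\<^sup>+\<omega>. e2ennreal (N \<omega>) \<partial>P)))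
    (\<lambda>j \<omega>. \<epsilon> \<omega> * \<xi> j \<omega> / R \<omega>)"
proof (rule exchangeable_densityI_symmetric[OF pos])
  have \<epsilon>[measurable]: "\<epsilon> \<in> borel_measurable P"
    using ind by (simp add: indep_random_variables_def)
  note sign = fair_sign[OF \<epsilon> half]
  show "(\<lambda>\<omega>. \<epsilon> \<omega> * \<xi> j \<omega> / R \<omega>) \<in> borel_measurable P" for j by measurable
  fix k :: nat and \<sigma> :: "nat \<Rightarrow> nat" and u :: "nat \<Rightarrow> real"
  let ?S = "\<lambda>\<omega>. \<Sum>j<k. u j * (\<xi> (\<sigma> j) \<omega> / R \<omega>)"
  have S: "(\<Sum>j<k. u j * (\<epsilon> \<omega> * \<xi> (\<sigma> j) \<omega> / R \<omega>)) = \<epsilon> \<omega> * ?S \<omega>" for \<omega>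
    by (simp add: sum_distrib_left mult_ac)
  show "AE \<omega> in P. cos (\<Sum>j<k. u j * (\<epsilon> \<omega> * \<xi> (\<sigma> j) \<omega> / R \<omega>)) = cos (?S \<omega>)"
    unfolding S using sign(1) by eventually_elim auto
  have "(\<integral>\<omega>. R \<omega> * sin (\<epsilon> \<omega> * ?S \<omega>) \<partial>P) = (\<integral>\<omega>. \<epsilon> \<omega> * sin_functional k \<sigma> u (\<lambda>j. \<xi> j \<omega>) \<partial>P)"
    unfolding sin_functional_xi
  proof (rule integral_cong_AE)
    show "AE \<omega> in P. R \<omega> * sin (\<epsilon> \<omega> * ?S \<omega>) = \<epsilon> \<omega> * (R \<omega> * sin (?S \<omega>))"
      using sign(1) by eventually_elim auto
  qed measurable
  also have "\<dots> = (\<integral>\<omega>. \<epsilon> \<omega> \<partial>P) * (\<integral>\<omega>. sin_functional k \<sigma> u (\<lambda>j. \<xi> j \<omega>) \<partial>P)"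
  proof (rule indep_random_variables_integral_mult[OF ind _ sign(2)])
    show "integrable P (\<lambda>\<omega>. sin_functional k \<sigma> u (\<lambda>j. \<xi> j \<omega>))"
      unfolding sin_functional_xi by (rule R_mult_bounded_integrable) auto
  qed measurable
  finally show "(\<integral>\<omega>. R \<omega> * sin (\<Sum>j<k. u j * (\<epsilon> \<omega> * \<xi> (\<sigma> j) \<omega> / R \<omega>)) \<partial>P) = 0"
    unfolding S sign(3) by simp
qed

text \<open>By symmetry the sine integral equals its own negative, hence it is 0.\<close>

lemma exchangeable_symmetric:
  assumes pos: "0 < (\<integral>\<^sup>+\<omega>. e2ennreal (N \<omega>) \<partial>P)"
    and sym: "symmetric_seq P \<xi>"
  shows "exchangeable (density P (\<lambda>\<omega>. e2ennreal (N \<omega>) / (\<integral>\<^sup>+\<omega>. e2ennreal (N \<omega>) \<partial>P)))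
    (\<lambda>j \<omega>. \<xi> j \<omega> / R \<omega>)"
proof (rule exchangeable_densityI_symmetric[OF pos])
  fix k :: nat and \<sigma> :: "nat \<Rightarrow> nat" and u :: "nat \<Rightarrow> real"
  let ?H = "sin_functional k \<sigma> u"
  have m: "(\<lambda>\<omega> j. \<xi> j \<omega>) \<in> measurable P (Pi\<^sub>M UNIV (\<lambda>_. borel))" "(\<lambda>\<omega> j. - \<xi> j \<omega>) \<in> measurable P (Pi\<^sub>M UNIV (\<lambda>_. borel))"
    by (intro measurable_PiM_single'; simp)+
  have "(\<integral>\<omega>. ?H (\<lambda>j. \<xi> j \<omega>) \<partial>P) = (\<integral>x. ?H x \<partial>distr P (Pi\<^sub>M UNIV (\<lambda>_. borel)) (\<lambda>\<omega> j. \<xi> j \<omega>))"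
    using m(1) by (simp add: integral_distr)
  also have "\<dots> = (\<integral>x. ?H x \<partial>distr P (Pi\<^sub>M UNIV (\<lambda>_. borel)) (\<lambda>\<omega> j. - \<xi> j \<omega>))"
    using sym by (simp add: symmetric_seq_def)
  also have "\<dots> = - (\<integral>\<omega>. ?H (\<lambda>j. \<xi> j \<omega>) \<partial>P)"
    using m(2) by (simp add: integral_distr sin_functional_uminus)
  finally show "(\<integral>\<omega>. R \<omega> * sin (\<Sum>j<k. u j * (\<xi> (\<sigma> j) \<omega> / R \<omega>)) \<partial>P) = 0"
    by (simp add: sin_functional_xi)
qed simp_all

text \<open>Almost surely \<open>\<xi> / R\<close> equals its absolute value. Written with
  \<open>\<phi> = abs\<close>, every test function is even, so arbitrary phases are admissible
  without splitting off a sine part.\<close>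

lemma exchangeable_nonneg:
  assumes pos: "0 < (\<integral>\<^sup>+\<omega>. e2ennreal (N \<omega>) \<partial>P)"
    and nonneg: "\<And>j. AE \<omega> in P. 0 \<le> \<xi> j \<omega>"
  shows "exchangeable (density P (\<lambda>\<omega>. e2ennreal (N \<omega>) / (\<integral>\<^sup>+\<omega>. e2ennreal (N \<omega>) \<partial>P)))
    (\<lambda>j \<omega>. \<xi> j \<omega> / R \<omega>)"
proof (rule exchangeable_densityI[OF pos])
  fix k :: nat and \<pi> \<theta> and u :: "nat \<Rightarrow> real" assume \<pi>: "\<pi> permutes {..<k}"
  have nn: "AE \<omega> in P. \<forall>j. 0 \<le> \<xi> j \<omega>" using nonneg by (simp add: AE_all_countable)
  have abs: "(\<integral>\<omega>. R \<omega> * cos (\<theta> + (\<Sum>j<k. u j * (\<xi> (\<sigma> j) \<omega> / R \<omega>))) \<partial>P) =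
    (\<integral>\<omega>. R \<omega> * cos (\<theta> + (\<Sum>j<k. u j * \<bar>\<xi> (\<sigma> j) \<omega> / R \<omega>\<bar>)) \<partial>P)" for \<sigma>
  proof (rule integral_cong_AE)
    show "AE \<omega> in P. R \<omega> * cos (\<theta> + (\<Sum>j<k. u j * (\<xi> (\<sigma> j) \<omega> / R \<omega>))) = R \<omega> * cos (\<theta> + (\<Sum>j<k. u j * \<bar>\<xi> (\<sigma> j) \<omega> / R \<omega>\<bar>))"
      using nn by eventually_elim (simp add: R_nonneg)
  qed measurable
  show "(\<integral>\<omega>. R \<omega> * cos (\<theta> + (\<Sum>j<k. u j * (\<xi> (\<pi> j) \<omega> / R \<omega>))) \<partial>P) =
    (\<integral>\<omega>. R \<omega> * cos (\<theta> + (\<Sum>j<k. u j * (\<xi> j \<omega> / R \<omega>))) \<partial>P)"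
    unfolding abs[of \<pi>] abs[of "\<lambda>j. j"]
    by (rule normalised_integral_permute[of "\<lambda>x. cos (\<theta> + x)" abs, OF _ _ _ _ \<pi>]) (auto intro!: continuous_intros)
qed simp

end

theorem theorem3p11:
  fixes P Q :: "'a measure" and \<xi> :: "nat \<Rightarrow> 'a \<Rightarrow> real" and p :: ereal
    and N :: "'a \<Rightarrow> ereal"
  assumes "prob_space P"
    and "1 \<le> p"
    and "swap_invariant P \<xi>"
    and N: "N = (\<lambda>\<omega>. limsup_norm p (\<lambda>j. \<xi> j \<omega>))"
    and "AE \<omega> in P. (\<lambda>n. ereal (partial_norm p n (\<lambda>j. \<xi> j \<omega>))) \<longlonglongrightarrow> N \<omega>"
    and "tendsto_L1 P (\<lambda>n \<omega>. partial_norm p n (\<lambda>j. \<xi> j \<omega>)) N"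
    and "0 < (\<integral>\<^sup>+ \<omega>. e2ennreal (N \<omega>) \<partial>P)"
    and Q: "Q = density P (\<lambda>\<omega>. e2ennreal (N \<omega>) / (\<integral>\<^sup>+ \<omega>. e2ennreal (N \<omega>) \<partial>P))"
  shows "(\<forall>\<epsilon> :: 'a \<Rightarrow> real.
            indep_random_variables P borel \<epsilon> (Pi\<^sub>M UNIV (\<lambda>_. borel)) (\<lambda>\<omega> j. \<xi> j \<omega>) \<and>
            measure P {\<omega> \<in> space P. \<epsilon> \<omega> = 1} = 1 / 2 \<and>
            measure P {\<omega> \<in> space P. \<epsilon> \<omega> = -1} = 1 / 2 \<longrightarrow>
            (\<exists>\<zeta>. exchangeable Q \<zeta> \<and>
                 (\<forall>j. AE \<omega> in P. ereal (\<epsilon> \<omega> * \<xi> j \<omega>) = N \<omega> * ereal (\<zeta> j \<omega>)))) \<and>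
         (symmetric_seq P \<xi> \<or> (\<forall>j. AE \<omega> in P. 0 \<le> \<xi> j \<omega>) \<longrightarrow>
            (\<exists>\<eta>. exchangeable Q \<eta> \<and>
                 (\<forall>j. AE \<omega> in P. ereal (\<xi> j \<omega>) = N \<omega> * ereal (\<eta> j \<omega>))))"
proof -
  interpret S: convergent_swap_invariant P \<xi> p
    using assms unfolding convergent_swap_invariant_def convergent_swap_invariant_axioms_def by simp
  have N_eq: "N = S.N" by (simp add: N S.N_def fun_eq_iff)
  note pos = \<open>0 < (\<integral>\<^sup>+ \<omega>. e2ennreal (N \<omega>) \<partial>P)\<close>[unfolded N_eq]
  show ?thesis
    unfolding Q N_eq
  proof (intro conjI allI impI; (elim conjE)?)
    fix \<epsilon> :: "'a \<Rightarrow> real"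
    assume "indep_random_variables P borel \<epsilon> (Pi\<^sub>M UNIV (\<lambda>_. borel)) (\<lambda>\<omega> j. \<xi> j \<omega>)"
      and "measure P {\<omega> \<in> space P. \<epsilon> \<omega> = 1} = 1 / 2" "measure P {\<omega> \<in> space P. \<epsilon> \<omega> = -1} = 1 / 2"
    note S.exchangeable_random_sign[OF pos this]
    moreover have "AE \<omega> in P. ereal (\<epsilon> \<omega> * \<xi> j \<omega>) = S.N \<omega> * ereal (\<epsilon> \<omega> * \<xi> j \<omega> / S.R \<omega>)" for j
      by (rule S.xi_eq_normalised) simp
    ultimately show "\<exists>\<zeta>. exchangeable (density P (\<lambda>\<omega>. e2ennreal (S.N \<omega>) / (\<integral>\<^sup>+ \<omega>. e2ennreal (S.N \<omega>) \<partial>P))) \<zeta> \<and>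
      (\<forall>j. AE \<omega> in P. ereal (\<epsilon> \<omega> * \<xi> j \<omega>) = S.N \<omega> * ereal (\<zeta> j \<omega>))" by blast
  next
    assume "symmetric_seq P \<xi> \<or> (\<forall>j. AE \<omega> in P. 0 \<le> \<xi> j \<omega>)"
    then have "exchangeable (density P (\<lambda>\<omega>. e2ennreal (S.N \<omega>) / (\<integral>\<^sup>+ \<omega>. e2ennreal (S.N \<omega>) \<partial>P))) (\<lambda>j \<omega>. \<xi> j \<omega> / S.R \<omega>)"
      using S.exchangeable_symmetric[OF pos] S.exchangeable_nonneg[OF pos] by blast
    moreover have "AE \<omega> in P. ereal (\<xi> j \<omega>) = S.N \<omega> * ereal (\<xi> j \<omega> / S.R \<omega>)" for j
      using S.xi_eq_normalised[where s="\<lambda>_. 1" and j=j and X="\<xi> j"] by simp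
    ultimately show "\<exists>\<eta>. exchangeable (density P (\<lambda>\<omega>. e2ennreal (S.N \<omega>) / (\<integral>\<^sup>+ \<omega>. e2ennreal (S.N \<omega>) \<partial>P))) \<eta> \<and>
      (\<forall>j. AE \<omega> in P. ereal (\<xi> j \<omega>) = S.N \<omega> * ereal (\<eta> j \<omega>))" by blast
  qed
qed

end
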